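(* (1) Let $\Bbbk$ be a field. The tensor product of metrized commutative $\Bbbk$-algebras $(\mathbb{A}_1,\circ_1,h_1)$ and $(\mathbb{A}_2,\circ_2,h_2)$, at least one of which is exact, is a metrized exact commutative $\Bbbk$-algebra. (2) Let $\Bbbk$ be a field. The tensor product of Killing metrized commutative $\Bbbk$-algebras $(\mathbb{A}_1,\circ_1)$ and $(\mathbb{A}_2,\circ_2)$, at least one of which is exact, is a Killing metrized exact commutative $\Bbbk$-algebra. (3) The tensor product $(\mathfrak{g}\otimes_{\Bbbk}\mathfrak{h},\circ)$ of semisimple Lie algebras $\mathfrak{g}$ and $\mathfrak{h}$ over a field $\Bbbk$ of characteristic zero is a Killing Einstein exact commutative algebra.
   Context: An algebra is a finite-dimensional vector space with a bilinear multiplication, not assumed unital or associative. $L_\circ(x)y = x\circ y$. A commutative algebra $(\mathbb{A},\circ)$ is exact if $\operatorname{tr}L_\circ(x)=0$ for all $x$. A bilinear form $h$ is invariant if $h(x\circ y,z) = h(x,y\circ z)$ for all $x,y,z$. A metrized commutative algebra $(\mathbb{A},\circ,h)$ is a commutative algebra with a nondegenerate invariant symmetric bilinear form $h$. The Killing form is $\tau_\circ(x,y) = \operatorname{tr}L_\circ(x)L_\circ(y)$; a commutative algebra is Killing metrized if $\tau_\circ$ is nondegenerate and invariant. A metrized commutative algebra $(\mathbb{A},\circ,h)$ is Killing Einstein if there is $0\neq\kappa\in\Bbbk$ with $\tau_\circ=\kappa h$ (a commutative algebra is called Killing Einstein, without mention of $h$, if this holds for some invariant metric $h$). The tensor product of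 two algebras that are both commutative or both anticommutative is $\mathbb{A}_1\otimes_{\Bbbk}\mathbb{A}_2$ with the commutative product determined by $(a_1\otimes b_1)\circ(a_2\otimes b_2) = (a_1\circ_1 a_2)\otimes(b_1\circ_2 b_2)$; for metrized algebras it is equipped with $h_1\otimes h_2$, where $(h_1\otimes h_2)(a_1\otimes b_1,a_2\otimes b_2) = h_1(a_1,a_2)h_2(b_1,b_2)$. For Lie algebras the multiplication is the Lie bracket. *)

theory Defs
  imports Complex_Main "HOL-Library.Poly_Mapping"
begin

section \<open>Bilinear maps and traces\<close>

definition bilinear_map ::
  "('k::field \<Rightarrow> 'a::ab_group_add \<Rightarrow> 'a) \<Rightarrow> ('k \<Rightarrow> 'b::ab_group_add \<Rightarrow> 'b) \<Rightarrow>
   ('k \<Rightarrow> 'c::ab_group_add \<Rightarrow> 'c) \<Rightarrow> ('a \<Rightarrow> 'b \<Rightarrow> 'c) \<Rightarrow> bool"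
  where "bilinear_map s1 s2 s3 f \<longleftrightarrow>
    (\<forall>x. Vector_Spaces.linear s2 s3 (\<lambda>y. f x y)) \<and>
    (\<forall>y. Vector_Spaces.linear s1 s3 (\<lambda>x. f x y))"

text \<open>The field is a vector space over itself with scaling \<open>(*)\<close>.\<close>

abbreviation bilinear_form ::
  "('k::field \<Rightarrow> 'a::ab_group_add \<Rightarrow> 'a) \<Rightarrow> ('a \<Rightarrow> 'a \<Rightarrow> 'k) \<Rightarrow> bool"
  where "bilinear_form s h \<equiv> bilinear_map s s (*) h"

text \<open>
  The trace of an endomorphism of a finite-dimensional space: the sum of the diagonal entries of its
  matrix in a basis. It does not depend on the basis chosen.
\<close>

definition lin_trace ::
  "('k::field \<Rightarrow> 'a::ab_group_add \<Rightarrow> 'a) \<Rightarrow> ('a \<Rightarrow> 'a) \<Rightarrow> 'k"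
  where "lin_trace s f =
    (let B = (SOME B. finite_dimensional_vector_space s B)
     in \<Sum>b\<in>B. module.representation s B (f b) b)"


section \<open>Algebras\<close>

locale fd_algebra = vector_space scale
  for scale :: "'k::field \<Rightarrow> 'a::ab_group_add \<Rightarrow> 'a" +
  fixes mult :: "'a \<Rightarrow> 'a \<Rightarrow> 'a"
  assumes finite_dimensional: "\<exists>B. finite_dimensional_vector_space scale B"
    and bilinear_mult: "bilinear_map scale scale scale mult"

locale comm_algebra = fd_algebra +
  assumes commutative: "mult x y = mult y x"

locale exact_comm_algebra = comm_algebra +
  assumes exact: "lin_trace scale (mult x) = 0"

definition invariant_form :: "('a \<Rightarrow> 'a \<Rightarrow> 'a) \<Rightarrow> ('a \<Rightarrow> 'a \<Rightarrow> 'k) \<Rightarrow> bool"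
  where "invariant_form m h \<longleftrightarrow> (\<forall>x y z. h (m x y) z = h x (m y z))"

text \<open>Only used for symmetric forms, for which the left and right radicals agree.\<close>

definition nondegenerate_form :: "('a::zero \<Rightarrow> 'a \<Rightarrow> 'k::zero) \<Rightarrow> bool"
  where "nondegenerate_form h \<longleftrightarrow> (\<forall>x. (\<forall>y. h x y = 0) \<longrightarrow> x = 0)"

locale metrized_comm_algebra = comm_algebra scale mult
  for scale :: "'k::field \<Rightarrow> 'a::ab_group_add \<Rightarrow> 'a" and mult :: "'a \<Rightarrow> 'a \<Rightarrow> 'a" +
  fixes h :: "'a \<Rightarrow> 'a \<Rightarrow> 'k"
  assumes bilinear_metric: "bilinear_form scale h"
    and symmetric_metric: "h x y = h y x"
    and nondegenerate_metric: "nondegenerate_form h"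
    and invariant_metric: "invariant_form mult h"

definition killing_form ::
  "('k::field \<Rightarrow> 'a::ab_group_add \<Rightarrow> 'a) \<Rightarrow> ('a \<Rightarrow> 'a \<Rightarrow> 'a) \<Rightarrow> 'a \<Rightarrow> 'a \<Rightarrow> 'k"
  where "killing_form s m x y = lin_trace s (m x \<circ> m y)"

locale killing_metrized_comm_algebra = comm_algebra +
  assumes nondegenerate_killing: "nondegenerate_form (killing_form scale mult)"
    and invariant_killing: "invariant_form mult (killing_form scale mult)"

definition killing_einstein ::
  "('k::field \<Rightarrow> 'a::ab_group_add \<Rightarrow> 'a) \<Rightarrow> ('a \<Rightarrow> 'a \<Rightarrow> 'a) \<Rightarrow> bool"
  where "killing_einstein s m \<longleftrightarrow>
    (\<exists>h \<kappa>. metrized_comm_algebra s m h \<and> \<kappa> \<noteq> 0 \<and>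
           (\<forall>x y. killing_form s m x y = \<kappa> * h x y))"


section \<open>Lie algebras\<close>

locale lie_algebra = fd_algebra scale bracket
  for scale :: "'k::field \<Rightarrow> 'a::ab_group_add \<Rightarrow> 'a" and bracket :: "'a \<Rightarrow> 'a \<Rightarrow> 'a" +
  assumes alternating: "bracket x x = 0"
    and jacobi: "bracket x (bracket y z) + bracket y (bracket z x) + bracket z (bracket x y) = 0"

definition lie_ideal ::
  "('k::field \<Rightarrow> 'a::ab_group_add \<Rightarrow> 'a) \<Rightarrow> ('a \<Rightarrow> 'a \<Rightarrow> 'a) \<Rightarrow> 'a set \<Rightarrow> bool"
  where "lie_ideal s br I \<longleftrightarrow> module.subspace s I \<and> (\<forall>x. \<forall>y\<in>I. br x y \<in> I)"

definition derived_subalgebra ::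
  "('k::field \<Rightarrow> 'a::ab_group_add \<Rightarrow> 'a) \<Rightarrow> ('a \<Rightarrow> 'a \<Rightarrow> 'a) \<Rightarrow> 'a set \<Rightarrow> 'a set"
  where "derived_subalgebra s br I = module.span s {br x y | x y. x \<in> I \<and> y \<in> I}"

definition lie_solvable ::
  "('k::field \<Rightarrow> 'a::ab_group_add \<Rightarrow> 'a) \<Rightarrow> ('a \<Rightarrow> 'a \<Rightarrow> 'a) \<Rightarrow> 'a set \<Rightarrow> bool"
  where "lie_solvable s br I \<longleftrightarrow> (\<exists>n. (derived_subalgebra s br ^^ n) I = {0})"

text \<open>Semisimple means that the radical vanishes; the zero Lie algebra is semisimple.\<close>

locale semisimple_lie_algebra = lie_algebra +
  assumes semisimple: "lie_ideal scale bracket I \<Longrightarrow> lie_solvable scale bracket I \<Longrightarrow> I = {0}"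


section \<open>Tensor products\<close>

text \<open>
  The free vector space on \<open>'a \<times> 'b\<close> is the type of finitely supported functions
  \<open>('a \<times> 'b) \<Rightarrow>\<^sub>0 'k\<close>, and the tensor product is its quotient by the span of \<open>tensor_relations\<close>.
  A type cannot depend on the scalings, so the quotient is not formed as a type. Instead,
  \<open>is_tensor_product s1 s2 st t\<close> says that the linear map from the free vector space given by
  \<open>(a, b) \<mapsto> t a b\<close> induces an isomorphism of that quotient onto the space with scaling
  \<open>st\<close>; so \<open>t a b\<close> is \<open>a \<otimes> b\<close>.
\<close>

definition free_scale :: "'k::field \<Rightarrow> ('i \<Rightarrow>\<^sub>0 'k) \<Rightarrow> ('i \<Rightarrow>\<^sub>0 'k)"
  where "free_scale c f = Poly_Mapping.map ((*) c) f"

definition free_lift ::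
  "('k::field \<Rightarrow> 'c::ab_group_add \<Rightarrow> 'c) \<Rightarrow> ('a \<Rightarrow> 'b \<Rightarrow> 'c) \<Rightarrow> ('a \<times> 'b \<Rightarrow>\<^sub>0 'k) \<Rightarrow> 'c"
  where "free_lift s t f =
    (\<Sum>(a, b)\<in>Poly_Mapping.keys f. s (Poly_Mapping.lookup f (a, b)) (t a b))"

definition pure :: "'a \<Rightarrow> 'b \<Rightarrow> ('a \<times> 'b \<Rightarrow>\<^sub>0 'k::field)"
  where "pure a b = Poly_Mapping.single (a, b) 1"

definition tensor_relations ::
  "('k::field \<Rightarrow> 'a::ab_group_add \<Rightarrow> 'a) \<Rightarrow> ('k \<Rightarrow> 'b::ab_group_add \<Rightarrow> 'b) \<Rightarrow>
   ('a \<times> 'b \<Rightarrow>\<^sub>0 'k) set"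
  where "tensor_relations s1 s2 =
    {pure (a + a') b - pure a b - pure a' b | a a' b. True} \<union>
    {pure a (b + b') - pure a b - pure a b' | a b b'. True} \<union>
    {pure (s1 c a) b - free_scale c (pure a b) | c a b. True} \<union>
    {pure a (s2 c b) - free_scale c (pure a b) | c a b. True}"

definition is_tensor_product ::
  "('k::field \<Rightarrow> 'a::ab_group_add \<Rightarrow> 'a) \<Rightarrow> ('k \<Rightarrow> 'b::ab_group_add \<Rightarrow> 'b) \<Rightarrow>
   ('k \<Rightarrow> 'c::ab_group_add \<Rightarrow> 'c) \<Rightarrow> ('a \<Rightarrow> 'b \<Rightarrow> 'c) \<Rightarrow> bool"
  where "is_tensor_product s1 s2 st t \<longleftrightarrow>
    vector_space s1 \<and> vector_space s2 \<and> vector_space st \<and>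
    surj (free_lift st t) \<and>
    {f. free_lift st t f = 0} = module.span free_scale (tensor_relations s1 s2)"

definition tensor_mult ::
  "('k::field \<Rightarrow> 'c::ab_group_add \<Rightarrow> 'c) \<Rightarrow> ('a \<Rightarrow> 'b \<Rightarrow> 'c) \<Rightarrow>
   ('a \<Rightarrow> 'a \<Rightarrow> 'a) \<Rightarrow> ('b \<Rightarrow> 'b \<Rightarrow> 'b) \<Rightarrow> 'c \<Rightarrow> 'c \<Rightarrow> 'c"
  where "tensor_mult st t m1 m2 =
    (THE m. bilinear_map st st st m \<and>
       (\<forall>a1 b1 a2 b2. m (t a1 b1) (t a2 b2) = t (m1 a1 a2) (m2 b1 b2)))"

definition tensor_form ::
  "('k::field \<Rightarrow> 'c::ab_group_add \<Rightarrow> 'c) \<Rightarrow> ('a \<Rightarrow> 'b \<Rightarrow> 'c) \<Rightarrow>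
   ('a \<Rightarrow> 'a \<Rightarrow> 'k) \<Rightarrow> ('b \<Rightarrow> 'b \<Rightarrow> 'k) \<Rightarrow> 'c \<Rightarrow> 'c \<Rightarrow> 'k"
  where "tensor_form st t h1 h2 =
    (THE h. bilinear_form st h \<and>
       (\<forall>a1 b1 a2 b2. h (t a1 b1) (t a2 b2) = h1 a1 a2 * h2 b1 b2))"

text \<open>
  Tensor products exist and have the universal property, and the definite descriptions in
  \<open>tensor_mult\<close> and \<open>tensor_form\<close> are proper: see \<open>tensor_product_exists\<close>,
  \<open>is_tensor_product_universal\<close>, \<open>tensor_mult_ex1\<close> and \<open>tensor_form_ex1\<close> below.
\<close>

lemma lookup_free_scale: "Poly_Mapping.lookup (free_scale c f) i = c * Poly_Mapping.lookup f i"
  unfolding free_scale_def by (simp add: Poly_Mapping.map.rep_eq when_def)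

lemma vector_space_free_scale: "vector_space (free_scale :: 'k::field \<Rightarrow> ('i \<Rightarrow>\<^sub>0 'k) \<Rightarrow> _)"
  by unfold_locales
    (auto intro!: poly_mapping_eqI simp: lookup_free_scale lookup_add algebra_simps)

lemma free_lift_superset:
  assumes "vector_space s" "finite K" "Poly_Mapping.keys f \<subseteq> K"
  shows "free_lift s t f = (\<Sum>(a, b)\<in>K. s (Poly_Mapping.lookup f (a, b)) (t a b))"
proof -
  interpret vector_space s by fact
  show ?thesis unfolding free_lift_def
    by (rule sum.mono_neutral_left) (use assms in \<open>auto simp: in_keys_iff\<close>)
qed

lemma linear_free_lift:
  assumes "vector_space s"
  shows "Vector_Spaces.linear free_scale s (free_lift s t)"
proof -
  interpret vector_space s by fact
  interpret F: vector_space "free_scale :: 'a \<Rightarrow> ('c \<times> 'd \<Rightarrow>\<^sub>0 'a) \<Rightarrow> _"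
    by (rule vector_space_free_scale)
  show ?thesis
  proof (unfold Vector_Spaces.linear_iff, intro conjI allI)
    fix f g :: "'c \<times> 'd \<Rightarrow>\<^sub>0 'a" and c
    let ?K = "Poly_Mapping.keys f \<union> Poly_Mapping.keys g"
    have K: "free_lift s t h = (\<Sum>(a, b)\<in>?K. s (Poly_Mapping.lookup h (a, b)) (t a b))"
      if "Poly_Mapping.keys h \<subseteq> ?K" for h
      by (rule free_lift_superset) (use assms that in auto)
    show "free_lift s t (f + g) = free_lift s t f + free_lift s t g"
      by (subst (1 2 3) K)
        (use keys_add[of f g] in \<open>auto simp: lookup_add scale_left_distrib split_def sum.distrib\<close>)
    show "free_lift s t (free_scale c f) = s c (free_lift s t f)"
      by (subst (1 2) K)
        (auto simp: in_keys_iff lookup_free_scale split_def scale_sum_right)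
  qed unfold_locales
qed

lemma free_lift_pure:
  assumes "vector_space s"
  shows "free_lift s t (pure a b) = t a b"
proof -
  interpret vector_space s by fact
  show ?thesis by (simp add: free_lift_def pure_def)
qed

lemma span_tensor_relations_kernel:
  assumes "bilinear_map s1 s2 sw f" "x \<in> module.span free_scale (tensor_relations s1 s2)"
  shows "free_lift sw f x = 0"
proof -
  have l1: "Vector_Spaces.linear s1 sw (\<lambda>x. f x y)" and l2: "Vector_Spaces.linear s2 sw (\<lambda>y. f x y)"
    for x y using assms(1) by (auto simp: bilinear_map_def)
  have W: "vector_space sw" using l1 by (auto simp: Vector_Spaces.linear_iff)
  interpret L: Vector_Spaces.linear free_scale sw "free_lift sw f" by (rule linear_free_lift[OF W])
  have "tensor_relations s1 s2 \<subseteq> {x. free_lift sw f x = 0}"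
    using l1 l2 unfolding tensor_relations_def
    by (auto simp: L.diff L.scale free_lift_pure[OF W] Vector_Spaces.linear_iff)
  then have "module.span free_scale (tensor_relations s1 s2) \<subseteq> {x. free_lift sw f x = 0}"
    by (rule L.vs1.span_minimal) (auto intro!: L.subspace_kernel)
  then show ?thesis using assms(2) by auto
qed

lemma is_tensor_product_bilinear:
  assumes "is_tensor_product s1 s2 st t"
  shows "bilinear_map s1 s2 st t"
proof -
  have V: "vector_space s1" "vector_space s2" and T: "vector_space st"
    and ker: "{f. free_lift st t f = 0} = module.span free_scale (tensor_relations s1 s2)"
    using assms by (auto simp: is_tensor_product_def)
  interpret L: Vector_Spaces.linear free_scale st "free_lift st t" by (rule linear_free_lift[OF T])
  have *: "free_lift st t x = 0" if "x \<in> tensor_relations s1 s2" for x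
    using ker L.vs1.span_base[OF that] by auto
  have "pure (a + a') b - pure a b - pure a' b \<in> tensor_relations s1 s2"
    "pure a (b + b') - pure a b - pure a b' \<in> tensor_relations s1 s2"
    "pure (s1 c a) b - free_scale c (pure a b) \<in> tensor_relations s1 s2"
    "pure a (s2 c b) - free_scale c (pure a b) \<in> tensor_relations s1 s2" for a a' b b' c
    unfolding tensor_relations_def by blast+
  from this[THEN *] show ?thesis using V T
    by (auto simp: bilinear_map_def Vector_Spaces.linear_iff L.diff L.add L.scale
        free_lift_pure[OF T] diff_diff_eq)
qed

theorem is_tensor_product_universal:
  assumes tp: "is_tensor_product s1 s2 st t" and f: "bilinear_map s1 s2 sw f"
  shows "\<exists>!g. Vector_Spaces.linear st sw g \<and> (\<forall>a b. g (t a b) = f a b)"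
proof -
  have T: "vector_space st" and surj: "surj (free_lift st t)"
    and ker: "{f. free_lift st t f = 0} = module.span free_scale (tensor_relations s1 s2)"
    using tp by (auto simp: is_tensor_product_def)
  have W: "vector_space sw" using f by (auto simp: bilinear_map_def Vector_Spaces.linear_iff)
  interpret T: Vector_Spaces.linear free_scale st "free_lift st t" by (rule linear_free_lift[OF T])
  interpret F: Vector_Spaces.linear free_scale sw "free_lift sw f" by (rule linear_free_lift[OF W])
  have ker_le: "free_lift sw f x = 0" if "free_lift st t x = 0" for x
    using that ker span_tensor_relations_kernel[OF f] by auto
  have eq: "free_lift sw f x = free_lift sw f y" if "free_lift st t x = free_lift st t y" for x y
    using ker_le[of "x - y"] that by (simp add: T.diff F.diff)
  define g where "g = free_lift sw f \<circ> inv (free_lift st t)"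
  have inv: "free_lift st t (inv (free_lift st t) z) = z" for z
    by (rule surj_f_inv_f[OF surj])
  have g: "g (free_lift st t x) = free_lift sw f x" for x
    unfolding g_def by (auto intro!: eq simp: inv)
  have lin: "Vector_Spaces.linear st sw g"
  proof (unfold Vector_Spaces.linear_iff, intro conjI allI T W)
    fix x y c
    obtain x' y' where "x = free_lift st t x'" "y = free_lift st t y'"
      using inv by metis
    then show "g (x + y) = g x + g y" "g (st c x) = sw c (g x)"
      by (simp_all add: g F.add F.scale flip: T.add T.scale)
  qed
  show ?thesis
  proof (rule ex1I)
    show "Vector_Spaces.linear st sw g \<and> (\<forall>a b. g (t a b) = f a b)"
      using lin g free_lift_pure[OF T] free_lift_pure[OF W] by metis
    fix g' assume g': "Vector_Spaces.linear st sw g' \<and> (\<forall>a b. g' (t a b) = f a b)"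
    interpret G: Vector_Spaces.linear st sw g' using g' by simp
    have "g' (free_lift st t x) = free_lift sw f x" for x
      using g' by (simp add: free_lift_def G.sum G.scale split_def)
    then show "g' = g" using g inv by (metis ext)
  qed
qed

lemma tensor_linear_ext:
  assumes tp: "is_tensor_product s1 s2 st t"
    and g: "Vector_Spaces.linear st sw g" "Vector_Spaces.linear st sw g'"
    and eq: "\<And>a b. g (t a b) = g' (t a b)"
  shows "g x = g' x"
proof -
  interpret G: Vector_Spaces.linear st sw g by fact
  interpret G': Vector_Spaces.linear st sw g' by fact
  obtain f where "x = free_lift st t f" using tp by (auto simp: is_tensor_product_def)
  then show ?thesis by (simp add: free_lift_def G.sum G.scale G'.sum G'.scale split_def eq)
qed

lemma tensor_bilinear_universal:
  assumes tp: "is_tensor_product s1 s2 st t"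
    and F1: "\<And>a2 b2. bilinear_map s1 s2 sw (\<lambda>a1 b1. F a1 b1 a2 b2)"
    and F2: "\<And>a1 b1. bilinear_map s1 s2 sw (\<lambda>a2 b2. F a1 b1 a2 b2)"
  shows "\<exists>!m. bilinear_map st st sw m \<and>
    (\<forall>a1 b1 a2 b2. m (t a1 b1) (t a2 b2) = F a1 b1 a2 b2)"
proof -
  have W: "vector_space sw" and V: "vector_space s1" "vector_space s2"
    using F1 by (auto simp: bilinear_map_def Vector_Spaces.linear_iff)
  have T: "vector_space st" using tp by (auto simp: is_tensor_product_def)
  interpret p: vector_space_pair st sw using T W by (simp add: vector_space_pair_def)
  obtain G where G: "\<And>a b. Vector_Spaces.linear st sw (G a b)"
    and Gt: "\<And>a1 b1 a2 b2. G a1 b1 (t a2 b2) = F a1 b1 a2 b2"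
    using is_tensor_product_universal[OF tp F2] by metis
  have "bilinear_map s1 s2 sw (\<lambda>a b. G a b z)" for z
  proof -
    have F1': "F (x + y) b a2 b2 = F x b a2 b2 + F y b a2 b2" "F (s1 c x) b a2 b2 = sw c (F x b a2 b2)"
      "F a (u + v) a2 b2 = F a u a2 b2 + F a v a2 b2" "F a (s2 c u) a2 b2 = sw c (F a u a2 b2)"
      for x y a u v b c a2 b2
      using F1[of a2 b2] by (auto simp: bilinear_map_def Vector_Spaces.linear_iff)
    have "G (x + y) b z = G x b z + G y b z" "G (s1 c x) b z = sw c (G x b z)"
      "G a (u + v) z = G a u z + G a v z" "G a (s2 c u) z = sw c (G a u z)" for x y a u v b c
      by (rule tensor_linear_ext[OF tp G], intro p.linear_compose_add p.linear_compose_scale_right G,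
          simp add: Gt F1')+
    then show ?thesis using V W by (simp add: bilinear_map_def Vector_Spaces.linear_iff)
  qed
  from is_tensor_product_universal[OF tp this]
  obtain H where H: "\<And>z. Vector_Spaces.linear st sw (H z)"
    and Ht: "\<And>z a b. H z (t a b) = G a b z" by metis
  have "H (x + y) z = H x z + H y z" "H (st c x) z = sw c (H x z)" for x y z c
    by (rule tensor_linear_ext[OF tp H], intro p.linear_compose_add p.linear_compose_scale_right H,
        use G in \<open>simp add: Ht Vector_Spaces.linear_iff\<close>)+
  then have H': "Vector_Spaces.linear st sw (\<lambda>z. H z x)" for x
    using T W by (simp add: Vector_Spaces.linear_iff)
  show ?thesis
  proof (rule ex1I)
    show "bilinear_map st st sw (\<lambda>x z. H z x) \<and>
        (\<forall>a1 b1 a2 b2. H (t a2 b2) (t a1 b1) = F a1 b1 a2 b2)"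
      using H H' by (simp add: bilinear_map_def Ht Gt)
    fix m assume m: "bilinear_map st st sw m \<and>
      (\<forall>a1 b1 a2 b2. m (t a1 b1) (t a2 b2) = F a1 b1 a2 b2)"
    then have m1: "Vector_Spaces.linear st sw (\<lambda>x. m x z)" and m2: "Vector_Spaces.linear st sw (m z)"
      for z by (auto simp: bilinear_map_def)
    have "m (t a b) z = H z (t a b)" for a b z
      by (rule tensor_linear_ext[OF tp m2 H']) (simp add: m Ht Gt)
    then have "m x z = H z x" for x z by (rule tensor_linear_ext[OF tp m1 H])
    then show "m = (\<lambda>x z. H z x)" by blast
  qed
qed

theorem tensor_mult_ex1:
  assumes tp: "is_tensor_product s1 s2 st t"
    and m1: "bilinear_map s1 s1 s1 m1" and m2: "bilinear_map s2 s2 s2 m2"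
  shows "\<exists>!m. bilinear_map st st st m \<and>
    (\<forall>a1 b1 a2 b2. m (t a1 b1) (t a2 b2) = t (m1 a1 a2) (m2 b1 b2))"
  by (rule tensor_bilinear_universal[OF tp])
    (use is_tensor_product_bilinear[OF tp] m1 m2
      in \<open>auto simp: bilinear_map_def Vector_Spaces.linear_iff\<close>)

theorem tensor_form_ex1:
  assumes tp: "is_tensor_product s1 s2 st t" and h1: "bilinear_form s1 h1" and h2: "bilinear_form s2 h2"
  shows "\<exists>!h. bilinear_form st h \<and>
    (\<forall>a1 b1 a2 b2. h (t a1 b1) (t a2 b2) = h1 a1 a2 * h2 b1 b2)"
  by (rule tensor_bilinear_universal[OF tp])
    (use h1 h2 in \<open>auto simp: bilinear_map_def Vector_Spaces.linear_iff algebra_simps\<close>)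

theorem tensor_product_exists:
  assumes "finite_dimensional_vector_space s1 B1" "finite_dimensional_vector_space s2 B2"
    "finite_dimensional_vector_space st C" "card C = card B1 * card B2"
  shows "\<exists>t. is_tensor_product s1 s2 st t"
proof -
  interpret V1: finite_dimensional_vector_space s1 B1 by fact
  interpret V2: finite_dimensional_vector_space s2 B2 by fact
  interpret T: finite_dimensional_vector_space st C by fact
  interpret Fr: vector_space "free_scale :: 'a \<Rightarrow> ('b \<times> 'c \<Rightarrow>\<^sub>0 'a) \<Rightarrow> _"
    by (rule vector_space_free_scale)
  have "card (B1 \<times> B2) = card C" using assms by (simp add: card_cartesian_product)
  then obtain \<phi> where \<phi>: "bij_betw \<phi> (B1 \<times> B2) C"
    using finite_same_card_bij[of "B1 \<times> B2" C] T.finite_Basis V1.finite_Basis V2.finite_Basis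
    by auto
  let ?r1 = "V1.representation B1" and ?r2 = "V2.representation B2"
  define t where "t a b = (\<Sum>(i, j)\<in>B1 \<times> B2. st (?r1 a i * ?r2 b j) (\<phi> (i, j)))" for a b
  have r1: "?r1 (x + y) i = ?r1 x i + ?r1 y i" "?r1 (s1 c x) i = c * ?r1 x i" for x y c i
    by (simp_all add: V1.representation_add V1.representation_scale V1.independent_Basis V1.span_Basis)
  have r2: "?r2 (x + y) i = ?r2 x i + ?r2 y i" "?r2 (s2 c x) i = c * ?r2 x i" for x y c i
    by (simp_all add: V2.representation_add V2.representation_scale V2.independent_Basis V2.span_Basis)
  have bil: "bilinear_map s1 s2 st t"
    unfolding bilinear_map_def Vector_Spaces.linear_iff t_def
    by (auto simp: V1.vector_space_axioms V2.vector_space_axioms T.vector_space_axioms r1 r2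
        algebra_simps split_def sum.distrib T.scale_sum_right)
  have tB: "t i j = \<phi> (i, j)" if "i \<in> B1" "j \<in> B2" for i j
  proof -
    have "t i j = (\<Sum>p\<in>B1 \<times> B2. if p = (i, j) then \<phi> (i, j) else 0)"
      unfolding t_def using that
      by (intro sum.cong) (auto simp: V1.representation_basis V2.representation_basis
          V1.independent_Basis V2.independent_Basis split: if_splits)
    then show ?thesis using that V1.finite_Basis V2.finite_Basis by simp
  qed
  interpret L: Vector_Spaces.linear free_scale st "free_lift st t"
    by (rule linear_free_lift) (rule T.vector_space_axioms)
  note Lp = free_lift_pure[OF T.vector_space_axioms, of t]
  have C: "C = \<phi> ` (B1 \<times> B2)" using \<phi> by (simp add: bij_betw_def)
  have "C \<subseteq> range (free_lift st t)"
    unfolding C by clarsimp (metis tB Lp rangeI)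
  moreover have "T.subspace (range (free_lift st t))" by (intro L.subspace_image Fr.subspace_UNIV)
  ultimately have surj: "surj (free_lift st t)"
    using T.span_minimal[of C "range (free_lift st t)"] T.span_Basis by blast
  let ?R = "tensor_relations s1 s2" and ?P = "(\<lambda>(i, j). pure i j) ` (B1 \<times> B2)"
  let ?S = "Fr.span (?P \<union> ?R)"
  have R: "x \<in> ?S" if "x \<in> ?R" for x using that by (simp add: Fr.span_base)
  have S1: "pure (a + a') b - (pure a b + pure a' b) \<in> ?S"
    and S2: "pure a (b + b') - (pure a b + pure a b') \<in> ?S"
    and S3: "pure (s1 c a) b - free_scale c (pure a b) \<in> ?S"
    and S4: "pure a (s2 c b) - free_scale c (pure a b) \<in> ?S" for a a' b b' c
    by (rule R, simp only: tensor_relations_def diff_diff_eq[symmetric], blast)+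
  have dd: "x \<in> ?S" if "x - y \<in> ?S" "y \<in> ?S" for x y
    using Fr.span_add[OF that] by simp
  have sub1: "V1.subspace {a. pure a b \<in> ?S}" for b
    unfolding V1.subspace_def
    using dd[OF S1 Fr.span_add] dd[OF S3 Fr.span_scale] S3[of 0 0 b] by auto
  have sub2: "V2.subspace {b. pure a b \<in> ?S}" for a
    unfolding V2.subspace_def
    using dd[OF S2 Fr.span_add] dd[OF S4 Fr.span_scale] S4[of a 0 0] by auto
  have "pure i j \<in> ?S" if "i \<in> B1" "j \<in> B2" for i j
    using that by (intro Fr.span_base) auto
  then have "B2 \<subseteq> {b. pure i b \<in> ?S}" if "i \<in> B1" for i using that by auto
  from V2.span_minimal[OF this sub2] have "pure i b \<in> ?S" if "i \<in> B1" for i b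
    using that V2.span_Basis by auto
  then have "B1 \<subseteq> {a. pure a b \<in> ?S}" for b by auto
  from V1.span_minimal[OF this sub1] have pS: "pure a b \<in> ?S" for a b
    using V1.span_Basis by auto
  have S: "f \<in> ?S" for f
  proof -
    have "f = (\<Sum>(a, b)\<in>Poly_Mapping.keys f. free_scale (Poly_Mapping.lookup f (a, b)) (pure a b))"
      by (rule poly_mapping_eqI)
        (auto simp: lookup_sum split_def lookup_free_scale pure_def lookup_single when_def in_keys_iff
            if_distrib[of "\<lambda>x. _ * x"] cong: if_cong)
    also have "\<dots> \<in> ?S" by (auto intro!: Fr.span_sum Fr.span_scale pS)
    finally show ?thesis .
  qed
  have "f \<in> Fr.span ?R" if f: "free_lift st t f = 0" for f
  proof -
    from S[of f] obtain e r where er: "f = e + r" "e \<in> Fr.span ?P" "r \<in> Fr.span ?R"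
      unfolding Fr.span_Un by blast
    have "free_lift st t r = 0"
      by (rule span_tensor_relations_kernel[OF bil er(3)])
    then have Le: "free_lift st t e = 0" using f er by (simp add: L.add)
    have "inj_on (\<lambda>(i, j). pure i j :: 'b \<times> 'c \<Rightarrow>\<^sub>0 'a) (B1 \<times> B2)"
    proof (rule inj_onI)
      fix p q assume pq: "p \<in> B1 \<times> B2" "q \<in> B1 \<times> B2"
        and "((case p of (i, j) \<Rightarrow> pure i j) :: 'b \<times> 'c \<Rightarrow>\<^sub>0 'a) = (case q of (i, j) \<Rightarrow> pure i j)"
      then have "t (fst p) (snd p) = t (fst q) (snd q)"
        by (metis Lp split_def)
      then show "p = q" using pq \<phi> by (auto simp: tB bij_betw_def inj_on_def)
    qed
    then obtain c where e: "e = (\<Sum>p\<in>B1 \<times> B2. free_scale (c p) (case p of (i, j) \<Rightarrow> pure i j))"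
      using er(2) V1.finite_Basis V2.finite_Basis
      by (auto simp: Fr.span_finite sum.reindex)
    have "0 = (\<Sum>p\<in>B1 \<times> B2. st (c p) (\<phi> p))"
      unfolding Le[symmetric] e L.sum L.scale by (intro sum.cong) (auto simp: L.scale Lp tB)
    also have "\<dots> = (\<Sum>x\<in>C. st (c (inv_into (B1 \<times> B2) \<phi> x)) x)"
      using \<phi> by (subst sum.reindex_bij_betw[OF \<phi>, symmetric])
        (auto intro!: sum.cong simp: bij_betw_def)
    finally have sum0: "(\<Sum>x\<in>C. st (c (inv_into (B1 \<times> B2) \<phi> x)) x) = 0" by simp
    have "c p = 0" if "p \<in> B1 \<times> B2" for p
    proof -
      have "\<phi> p \<in> C" using that C by auto
      from T.independentD[OF T.independent_Basis T.finite_Basis order_refl sum0 this]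
      show ?thesis using \<phi> that by (simp add: bij_betw_def)
    qed
    then have "e = 0" unfolding e by (intro sum.neutral) simp
    then show ?thesis using er by simp
  qed
  then have "{f. free_lift st t f = 0} = Fr.span ?R"
    using span_tensor_relations_kernel[OF bil] by blast
  then show ?thesis
    using surj V1.vector_space_axioms V2.vector_space_axioms T.vector_space_axioms
    unfolding is_tensor_product_def by blast
qed

end

theory Submission
  imports Defs "HOL-Algebra.Algebraic_Closure_Type" "HOL-Library.Function_Algebras"
begin

text \<open>
  Everything about the tensor product is decided on pure tensors. If \<open>B1\<close> and \<open>B2\<close> are bases of the
  factors, then the \<open>i \<otimes> j\<close> form a basis of the product, so \<open>tr (f \<otimes> g) = tr f \<cdot> tr g\<close>
  (\<open>lin_trace_tensor\<close>). Applied to \<open>L(a) \<otimes> L(b)\<close> this gives exactness as soon as one factor is exact,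
  and applied to \<open>L(a) L(a') \<otimes> L(b) L(b')\<close> it says that the Killing form of the tensor product is the
  tensor product of the Killing forms (\<open>tensor_killing_form\<close>). A tensor product of nondegenerate forms
  is nondegenerate, one index at a time (\<open>tensor_form_nondegenerate\<close>), and symmetry and invariance
  extend from pure tensors. The first two statements follow; in the second, the Killing forms are
  themselves the metrics. The product of two anticommutative products is commutative, so the same
  argument gives the third statement with Einstein constant \<open>1\<close>, once a semisimple Lie algebra in
  characteristic zero is known to have a nondegenerate Killing form and traceless adjoint operators.

  Nondegeneracy is Cartan's criterion (\<open>cartan_criterion\<close>). The radical \<open>R\<close> of the Killing form is an
  ideal; its derived series stabilizes at a perfect subalgebra \<open>J\<close> on which the Killing form vanishes,
  and \<open>J = 0\<close> has to be shown, for then \<open>R\<close> is solvable and hence zero. The first step is that every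
  \<open>ad x\<close> with \<open>x \<in> J\<close> is nilpotent. This is proved after extension of scalars to the algebraic closure
  \<open>K\<close>, for the \<open>K\<close>-span \<open>W\<close> of \<open>ad J\<close> (\<open>trace_orthogonal_imp_nilpotent\<close>). For a \<open>\<rat>\<close>-linear map
  \<open>\<phi>\<close> from \<open>K\<close> to \<open>\<rat>\<close>, let \<open>d\<close> multiply each generalized eigenspace of \<open>ad x\<close>, with
  eigenvalue \<open>\<lambda>\<close>, by \<open>\<phi> \<lambda>\<close>. Commutation with \<open>ad x\<close> splits \<open>W\<close> into generalized eigenspaces, and an
  operator with eigenvalue \<open>c\<close> there raises eigenvalues of \<open>ad x\<close> by \<open>c\<close>; therefore \<open>[d, W] \<subseteq> W\<close>.
  Since \<open>ad x\<close> is a sum of commutators \<open>[a, b]\<close> in \<open>W\<close> and \<open>tr (d [a, b]) = tr ([d, a] b) = 0\<close>, the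
  eigenvalues satisfy \<open>\<Sum> \<phi> \<lambda> \<cdot> \<lambda> = 0\<close>. Applying \<open>\<phi>\<close> makes this a vanishing sum of rational squares,
  so every \<open>\<phi>\<close> kills every eigenvalue, and all eigenvalues are zero.
  The second step is Engel's theorem: \<open>J\<close> acts nilpotently, so a perfect \<open>J\<close> is zero
  (\<open>perfect_nilpotent_trivial\<close>).

  Finally, nondegeneracy represents the linear form \<open>x \<mapsto> tr (ad x)\<close> as \<open>\<tau> z\<close>, where \<open>\<tau>\<close> is the
  Killing form; it vanishes on brackets, so \<open>\<tau> [z, x] y = \<tau> z [x, y] = 0\<close>, whence \<open>ad z = 0\<close> and the
  linear form is zero (\<open>semisimple_ad_trace_zero\<close>).
\<close>

section \<open>Traces\<close>

text \<open>
  The trace is taken over a basis of a subspace, because the extension of scalars below lives on a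
  finite-dimensional subspace of a function space and not on a whole type.
\<close>

definition basis_trace ::
  "('k::field \<Rightarrow> 'a::ab_group_add \<Rightarrow> 'a) \<Rightarrow> 'a set \<Rightarrow> ('a \<Rightarrow> 'a) \<Rightarrow> 'k"
  where "basis_trace s B f = (\<Sum>b\<in>B. Modules.module.representation s B (f b) b)"

lemma (in vector_space) representation_linear_expand:
  assumes "finite C" "independent C" "independent B" "x \<in> span C" "\<And>c. c \<in> C \<Longrightarrow> f c \<in> span B"
    "Vector_Spaces.linear scale scale f"
  shows "representation B (f x) b = (\<Sum>c\<in>C. representation C x c * representation B (f c) b)"
proof -
  interpret f: Vector_Spaces.linear scale scale f by fact
  have "f x = f (\<Sum>c\<in>C. scale (representation C x c) c)"
    using sum_representation_eq[OF assms(2,4,1)] by simp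
  also have "\<dots> = (\<Sum>c\<in>C. scale (representation C x c) (f c))"
    by (simp add: f.sum f.scale)
  finally show ?thesis
    using assms by (simp add: representation_sum representation_scale span_scale)
qed

text \<open>
  Both sides are the double sum of the matrix entries of \<open>f\<close> times those of \<open>g\<close>. With two
  different bases the identity contains independence of the basis (take \<open>g\<close> to be the identity) as
  well as the invariance of the trace under cyclic permutations.
\<close>

lemma (in vector_space) basis_trace_commute:
  assumes B: "finite B" "independent B" and C: "finite C" "independent C"
    and f: "Vector_Spaces.linear scale scale f" "\<And>c. c \<in> C \<Longrightarrow> f c \<in> span B"
    and g: "Vector_Spaces.linear scale scale g" "\<And>b. b \<in> B \<Longrightarrow> g b \<in> span C"
  shows "basis_trace scale B (\<lambda>b. f (g b)) = basis_trace scale C (\<lambda>c. g (f c))"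
proof -
  have "basis_trace scale B (\<lambda>b. f (g b))
      = (\<Sum>b\<in>B. \<Sum>c\<in>C. representation C (g b) c * representation B (f c) b)"
    unfolding basis_trace_def using assms
    by (intro sum.cong refl representation_linear_expand) auto
  also have "\<dots> = (\<Sum>c\<in>C. \<Sum>b\<in>B. representation B (f c) b * representation C (g b) c)"
    by (subst sum.swap) (simp only: mult.commute)
  also have "\<dots> = basis_trace scale C (\<lambda>c. g (f c))"
    unfolding basis_trace_def using assms
    by (intro sum.cong refl representation_linear_expand[symmetric]) auto
  finally show ?thesis .
qed

lemma (in vector_space) basis_trace_change_basis:
  assumes "finite B" "independent B" "finite C" "independent C" "span B = span C"
    and "Vector_Spaces.linear scale scale f" "\<And>v. v \<in> span B \<Longrightarrow> f v \<in> span B"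
  shows "basis_trace scale B f = basis_trace scale C f"
  using basis_trace_commute[OF assms(1-4,6) _ linear_id[unfolded id_def]] assms(5,7)
  by (metis span_base)

lemma (in vector_space) basis_trace_scale:
  assumes "finite B" "independent B" "\<And>b. b \<in> B \<Longrightarrow> f b \<in> span B"
  shows "basis_trace scale B (\<lambda>v. scale c (f v)) = c * basis_trace scale B f"
  using assms by (simp add: basis_trace_def representation_scale sum_distrib_left)

lemma (in vector_space) basis_trace_add_diff:
  assumes "finite B" "independent B" "\<And>b. b \<in> B \<Longrightarrow> f b \<in> span B" "\<And>b. b \<in> B \<Longrightarrow> g b \<in> span B"
  shows "basis_trace scale B (\<lambda>v. f v + g v) = basis_trace scale B f + basis_trace scale B g"
    and "basis_trace scale B (\<lambda>v. f v - g v) = basis_trace scale B f - basis_trace scale B g"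
  using assms
  by (simp_all add: basis_trace_def representation_add representation_diff sum.distrib sum_subtractf)

lemma lin_trace_eq_basis_trace:
  assumes "finite_dimensional_vector_space s B" "Vector_Spaces.linear s s f"
  shows "lin_trace s f = basis_trace s B f"
proof -
  interpret finite_dimensional_vector_space s B by fact
  define C where "C = (SOME B. finite_dimensional_vector_space s B)"
  have "finite_dimensional_vector_space s C" unfolding C_def by (rule someI) (rule assms)
  then interpret C: finite_dimensional_vector_space s C .
  have "basis_trace s C f = basis_trace s B f"
    by (rule basis_trace_change_basis)
      (simp_all add: C.finite_Basis C.independent_Basis C.span_Basis finite_Basis independent_Basis
        span_Basis assms(2))
  then show ?thesis by (simp add: lin_trace_def basis_trace_def Let_def C_def)
qed

lemma lin_trace_commute:
  assumes "finite_dimensional_vector_space s B" "Vector_Spaces.linear s s f" "Vector_Spaces.linear s s g"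
  shows "lin_trace s (f \<circ> g) = lin_trace s (g \<circ> f)"
proof -
  interpret finite_dimensional_vector_space s B by fact
  have "Vector_Spaces.linear s s (f \<circ> g)" "Vector_Spaces.linear s s (g \<circ> f)"
    using Vector_Spaces.linear_compose assms(2,3) by blast+
  then show ?thesis
    using basis_trace_commute[OF finite_Basis independent_Basis finite_Basis independent_Basis
        assms(2) _ assms(3)]
    by (simp add: lin_trace_eq_basis_trace[OF assms(1)] span_Basis comp_def)
qed

lemma lin_trace_add_diff:
  assumes fd: "finite_dimensional_vector_space s B"
    and f: "Vector_Spaces.linear s s f" and g: "Vector_Spaces.linear s s g"
  shows "lin_trace s (\<lambda>x. f x + g x) = lin_trace s f + lin_trace s g"
    and "lin_trace s (\<lambda>x. f x - g x) = lin_trace s f - lin_trace s g"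
proof -
  interpret finite_dimensional_vector_space s B by fact
  interpret p: vector_space_pair s s ..
  note tr = lin_trace_eq_basis_trace[OF fd]
  show "lin_trace s (\<lambda>x. f x + g x) = lin_trace s f + lin_trace s g"
    unfolding tr[OF p.linear_compose_add[OF f g]] tr[OF f] tr[OF g]
    by (rule basis_trace_add_diff(1)) (simp_all add: finite_Basis independent_Basis span_Basis)
  show "lin_trace s (\<lambda>x. f x - g x) = lin_trace s f - lin_trace s g"
    unfolding tr[OF p.linear_compose_sub[OF f g]] tr[OF f] tr[OF g]
    by (rule basis_trace_add_diff(2)) (simp_all add: finite_Basis independent_Basis span_Basis)
qed

lemma lin_trace_scale:
  assumes fd: "finite_dimensional_vector_space s B" and f: "Vector_Spaces.linear s s f"
  shows "lin_trace s (\<lambda>x. s c (f x)) = c * lin_trace s f"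
proof -
  interpret finite_dimensional_vector_space s B by fact
  interpret p: vector_space_pair s s ..
  note tr = lin_trace_eq_basis_trace[OF fd]
  show ?thesis
    unfolding tr[OF p.linear_compose_scale_right[OF f]] tr[OF f]
    by (rule basis_trace_scale) (simp_all add: finite_Basis independent_Basis span_Basis)
qed

section \<open>Coordinates on a tensor product\<close>

text \<open>
  The coordinate functionals come from the universal property, applied to products of coordinates;
  the expansion of \<open>z\<close> holds because both sides are linear in \<open>z\<close> and agree on pure tensors.
\<close>

lemma tensor_coordinates:
  fixes st :: "'k::field \<Rightarrow> 'c::ab_group_add \<Rightarrow> 'c"
  assumes tp: "is_tensor_product s1 s2 st t"
    and fd1: "finite_dimensional_vector_space s1 B1"
    and fd2: "finite_dimensional_vector_space s2 B2"
  obtains \<psi> where "\<And>i j. Vector_Spaces.linear st (*) (\<psi> i j)"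
    and "\<And>i j a b. \<psi> i j (t a b)
      = Modules.module.representation s1 B1 a i * Modules.module.representation s2 B2 b j"
    and "\<And>z. z = (\<Sum>(i, j)\<in>B1 \<times> B2. st (\<psi> i j z) (t i j))"
proof -
  interpret V1: finite_dimensional_vector_space s1 B1 by fact
  interpret V2: finite_dimensional_vector_space s2 B2 by fact
  interpret T: vector_space st using tp by (simp add: is_tensor_product_def)
  let ?r1 = "V1.representation B1" and ?r2 = "V2.representation B2"
  have "vector_space ((*) :: 'k \<Rightarrow> 'k \<Rightarrow> 'k)" by unfold_locales (simp_all add: algebra_simps)
  then have bil: "bilinear_map s1 s2 (*) (\<lambda>a b. ?r1 a i * ?r2 b j)" for i j
    using V1.vector_space_axioms V2.vector_space_axioms
    by (simp add: bilinear_map_def Vector_Spaces.linear_iff algebra_simps V1.representation_add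
        V1.representation_scale V1.independent_Basis V1.span_Basis V2.representation_add
        V2.representation_scale V2.independent_Basis V2.span_Basis)
  obtain \<psi> where lin: "\<And>i j. Vector_Spaces.linear st (*) (\<psi> i j)"
    and \<psi>: "\<And>i j a b. \<psi> i j (t a b) = ?r1 a i * ?r2 b j"
    using is_tensor_product_universal[OF tp bil] by metis
  note tb = is_tensor_product_bilinear[OF tp]
  have t1: "Vector_Spaces.linear s1 st (\<lambda>a. t a b)" and t2: "Vector_Spaces.linear s2 st (t a)" for a b
    using tb by (auto simp: bilinear_map_def)
  have "z = (\<Sum>(i, j)\<in>B1 \<times> B2. st (\<psi> i j z) (t i j))" for z
  proof (rule tensor_linear_ext[OF tp, where g = "\<lambda>z. z"])
    show "Vector_Spaces.linear st st (\<lambda>z. z)" by (rule T.linear_ident)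
    show "Vector_Spaces.linear st st (\<lambda>z. \<Sum>(i, j)\<in>B1 \<times> B2. st (\<psi> i j z) (t i j))"
      using lin by (simp add: Vector_Spaces.linear_iff split_def T.scale_left_distrib sum.distrib
          T.scale_sum_right T.vector_space_axioms)
    fix a b
    have "(\<Sum>(i, j)\<in>B1 \<times> B2. st (\<psi> i j (t a b)) (t i j))
        = (\<Sum>i\<in>B1. \<Sum>j\<in>B2. st (?r1 a i) (st (?r2 b j) (t i j)))"
      by (simp add: \<psi> sum.cartesian_product)
    also have "\<dots> = (\<Sum>i\<in>B1. st (?r1 a i) (\<Sum>j\<in>B2. st (?r2 b j) (t i j)))"
      by (simp add: T.scale_sum_right)
    also have "\<dots> = (\<Sum>i\<in>B1. st (?r1 a i) (t i b))"
    proof (intro sum.cong refl arg_cong[where f = "st _"])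
      fix i
      interpret L: Vector_Spaces.linear s2 st "t i" by (rule t2)
      have "t i b = t i (\<Sum>j\<in>B2. s2 (?r2 b j) j)"
        by (subst V2.sum_representation_eq) (auto simp: V2.independent_Basis V2.span_Basis V2.finite_Basis)
      then show "(\<Sum>j\<in>B2. st (?r2 b j) (t i j)) = t i b" by (simp add: L.sum L.scale)
    qed
    also have "\<dots> = t a b"
    proof -
      interpret L: Vector_Spaces.linear s1 st "\<lambda>a. t a b" by (rule t1)
      have "t a b = t (\<Sum>i\<in>B1. s1 (?r1 a i) i) b"
        by (subst V1.sum_representation_eq) (auto simp: V1.independent_Basis V1.span_Basis V1.finite_Basis)
      then show ?thesis by (simp add: L.sum L.scale)
    qed
    finally show "t a b = (\<Sum>(i, j)\<in>B1 \<times> B2. st (\<psi> i j (t a b)) (t i j))" by simp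
  qed
  with that[OF lin \<psi>] show ?thesis by blast
qed

text \<open>
  Independence follows from the coordinate functionals, which take the value \<open>1\<close> on one of the
  vectors and \<open>0\<close> on the others.
\<close>

lemma tensor_basis:
  assumes tp: "is_tensor_product s1 s2 st t"
    and fd1: "finite_dimensional_vector_space s1 B1"
    and fd2: "finite_dimensional_vector_space s2 B2"
  shows "inj_on (\<lambda>(i, j). t i j) (B1 \<times> B2)"
    and "finite_dimensional_vector_space st ((\<lambda>(i, j). t i j) ` (B1 \<times> B2))"
proof -
  interpret V1: finite_dimensional_vector_space s1 B1 by fact
  interpret V2: finite_dimensional_vector_space s2 B2 by fact
  interpret T: vector_space st using tp by (simp add: is_tensor_product_def)
  obtain \<psi> where lin: "\<And>i j. Vector_Spaces.linear st (*) (\<psi> i j)"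
    and \<psi>: "\<And>i j a b. \<psi> i j (t a b) = V1.representation B1 a i * V2.representation B2 b j"
    and z: "\<And>z. z = (\<Sum>(i, j)\<in>B1 \<times> B2. st (\<psi> i j z) (t i j))"
    using tensor_coordinates[OF assms] by blast
  have \<delta>: "\<psi> i j (t k l) = (if (k, l) = (i, j) then 1 else 0)" if "k \<in> B1" "l \<in> B2" for i j k l
    using that by (simp add: \<psi> V1.representation_basis V2.representation_basis V1.independent_Basis
        V2.independent_Basis)
  let ?f = "\<lambda>(i, j). t i j" and ?C = "(\<lambda>(i, j). t i j) ` (B1 \<times> B2)"
  show inj: "inj_on ?f (B1 \<times> B2)"
  proof (rule inj_onI, clarify)
    fix i j k l assume "i \<in> B1" "j \<in> B2" "k \<in> B1" "l \<in> B2" "t i j = t k l"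
    then have "(if (k, l) = (i, j) then 1 else 0 :: 'a) = 1" using \<delta>[of k l i j] \<delta>[of i j i j] by simp
    then show "i = k \<and> j = l" by (auto split: if_splits)
  qed
  have fin: "finite ?C" using V1.finite_Basis V2.finite_Basis by simp
  have "T.independent ?C"
  proof (rule T.independent_if_scalars_zero[OF fin])
    fix c x assume 0: "(\<Sum>x\<in>?C. st (c x) x) = 0" and "x \<in> ?C"
    then obtain i j where ij: "i \<in> B1" "j \<in> B2" "x = t i j" by auto
    interpret L: Vector_Spaces.linear st "(*)" "\<psi> i j" by (rule lin)
    have "0 = \<psi> i j (\<Sum>p\<in>B1 \<times> B2. st (c (?f p)) (?f p))"
      using 0 by (simp add: sum.reindex[OF inj] comp_def L.zero)
    also have "\<dots> = (\<Sum>p\<in>B1 \<times> B2. if p = (i, j) then c (t i j) else 0)"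
      unfolding L.sum by (intro sum.cong refl) (auto simp: L.scale \<delta> split: if_splits)
    also have "\<dots> = c x" using ij V1.finite_Basis V2.finite_Basis by simp
    finally show "c x = 0" by simp
  qed
  moreover have "(\<Sum>(i, j)\<in>B1 \<times> B2. st (\<psi> i j z) (t i j)) \<in> T.span ?C" for z
    by (intro T.span_sum) (auto intro: T.span_scale T.span_base)
  with z have "z \<in> T.span ?C" for z by metis
  ultimately show "finite_dimensional_vector_space st ?C"
    using fin by unfold_locales auto
qed

text \<open>
  The diagonal entry of \<open>f \<otimes> g\<close> at \<open>i \<otimes> j\<close> is the product of the diagonal entries of \<open>f\<close> at \<open>i\<close>
  and of \<open>g\<close> at \<open>j\<close>.
\<close>

lemma lin_trace_tensor:
  assumes tp: "is_tensor_product s1 s2 st t"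
    and fd1: "finite_dimensional_vector_space s1 B1"
    and fd2: "finite_dimensional_vector_space s2 B2"
    and f: "Vector_Spaces.linear s1 s1 f" and g: "Vector_Spaces.linear s2 s2 g"
    and F: "Vector_Spaces.linear st st F" and F_pure: "\<And>a b. F (t a b) = t (f a) (g b)"
  shows "lin_trace st F = lin_trace s1 f * lin_trace s2 g"
proof -
  let ?f = "\<lambda>(i, j). t i j" and ?C = "(\<lambda>(i, j). t i j) ` (B1 \<times> B2)"
  note inj = tensor_basis(1)[OF tp fd1 fd2] and fd = tensor_basis(2)[OF tp fd1 fd2]
  interpret V1: finite_dimensional_vector_space s1 B1 by fact
  interpret V2: finite_dimensional_vector_space s2 B2 by fact
  interpret T: finite_dimensional_vector_space st ?C by (rule fd)
  obtain \<psi> where lin: "\<And>i j. Vector_Spaces.linear st (*) (\<psi> i j)"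
    and \<psi>: "\<And>i j a b. \<psi> i j (t a b) = V1.representation B1 a i * V2.representation B2 b j"
    and z: "\<And>z. z = (\<Sum>(i, j)\<in>B1 \<times> B2. st (\<psi> i j z) (t i j))"
    using tensor_coordinates[OF tp fd1 fd2] by blast
  have rep: "T.representation ?C z (t i j) = \<psi> i j z" if ij: "i \<in> B1" "j \<in> B2" for i j z
  proof -
    have "z = (\<Sum>p\<in>B1 \<times> B2. st (\<psi> (fst p) (snd p) z) (?f p))"
      by (rule trans[OF z[of z]]) (auto intro: sum.cong)
    then have "T.representation ?C z (t i j)
        = T.representation ?C (\<Sum>p\<in>B1 \<times> B2. st (\<psi> (fst p) (snd p) z) (?f p)) (t i j)"
      by (rule arg_cong[where f = "\<lambda>x. T.representation ?C x (t i j)"])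
    also have "\<dots> = (\<Sum>p\<in>B1 \<times> B2. \<psi> (fst p) (snd p) z * T.representation ?C (?f p) (t i j))"
      by (simp add: T.representation_sum T.representation_scale T.independent_Basis T.span_Basis)
    also have "\<dots> = (\<Sum>p\<in>B1 \<times> B2. if p = (i, j) then \<psi> i j z else 0)"
    proof (rule sum.cong[OF refl])
      fix p assume p: "p \<in> B1 \<times> B2"
      have "T.representation ?C (?f p) (t i j) = (if ?f (i, j) = ?f p then 1 else 0)"
        using T.representation_basis[OF T.independent_Basis imageI[OF p]] by simp
      also have "(?f (i, j) = ?f p) = (p = (i, j))"
        using inj_on_eq_iff[OF inj, of "(i, j)" p] ij p by blast
      finally show "\<psi> (fst p) (snd p) z * T.representation ?C (?f p) (t i j)
          = (if p = (i, j) then \<psi> i j z else 0)" by simp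
    qed
    also have "\<dots> = \<psi> i j z" using ij V1.finite_Basis V2.finite_Basis by simp
    finally show ?thesis .
  qed
  have "lin_trace st F = (\<Sum>p\<in>B1 \<times> B2. T.representation ?C (F (?f p)) (?f p))"
    unfolding lin_trace_eq_basis_trace[OF fd F] basis_trace_def by (simp add: sum.reindex[OF inj])
  also have "\<dots> = (\<Sum>(i, j)\<in>B1 \<times> B2. V1.representation B1 (f i) i * V2.representation B2 (g j) j)"
    by (intro sum.cong refl) (auto simp: rep F_pure \<psi>)
  also have "\<dots> = lin_trace s1 f * lin_trace s2 g"
    unfolding lin_trace_eq_basis_trace[OF fd1 f] lin_trace_eq_basis_trace[OF fd2 g] basis_trace_def
    by (simp add: sum_product sum.cartesian_product)
  finally show ?thesis .
qed

section \<open>Products and forms on a tensor product\<close>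

lemma bilinear_map_iff:
  "bilinear_map s1 s2 s3 f \<longleftrightarrow> vector_space s1 \<and> vector_space s2 \<and> vector_space s3 \<and>
    (\<forall>x y z. f (x + y) z = f x z + f y z) \<and> (\<forall>c x z. f (s1 c x) z = s3 c (f x z)) \<and>
    (\<forall>x y z. f x (y + z) = f x y + f x z) \<and> (\<forall>c x z. f x (s2 c z) = s3 c (f x z))"
  by (auto simp: bilinear_map_def Vector_Spaces.linear_iff)

lemma vector_space_mult: "vector_space ((*) :: 'k::field \<Rightarrow> 'k \<Rightarrow> 'k)"
  by unfold_locales (simp_all add: algebra_simps)

lemma tensor_trilinear_ext:
  assumes tp: "is_tensor_product s1 s2 st t"
    and lin1: "\<And>y z. Vector_Spaces.linear st sw (\<lambda>x. F x y z)" "\<And>y z. Vector_Spaces.linear st sw (\<lambda>x. G x y z)"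
    and lin2: "\<And>x z. Vector_Spaces.linear st sw (\<lambda>y. F x y z)" "\<And>x z. Vector_Spaces.linear st sw (\<lambda>y. G x y z)"
    and lin3: "\<And>x y. Vector_Spaces.linear st sw (\<lambda>z. F x y z)" "\<And>x y. Vector_Spaces.linear st sw (\<lambda>z. G x y z)"
    and eq: "\<And>a b a' b' a'' b''. F (t a b) (t a' b') (t a'' b'') = G (t a b) (t a' b') (t a'' b'')"
  shows "F x y z = G x y z"
proof (rule tensor_linear_ext[OF tp lin1])
  fix a b show "F (t a b) y z = G (t a b) y z"
  proof (rule tensor_linear_ext[OF tp lin2])
    fix a' b' show "F (t a b) (t a' b') z = G (t a b) (t a' b') z"
      by (rule tensor_linear_ext[OF tp lin3]) (rule eq)
  qed
qed

lemma tensor_mult_spec: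
  assumes "is_tensor_product s1 s2 st t" "bilinear_map s1 s1 s1 m1" "bilinear_map s2 s2 s2 m2"
  shows "bilinear_map st st st (tensor_mult st t m1 m2)"
    and "tensor_mult st t m1 m2 (t a b) (t a' b') = t (m1 a a') (m2 b b')"
  using theI'[OF tensor_mult_ex1[OF assms]] unfolding tensor_mult_def by blast+

lemma tensor_form_spec:
  assumes "is_tensor_product s1 s2 st t" "bilinear_form s1 h1" "bilinear_form s2 h2"
  shows "bilinear_form st (tensor_form st t h1 h2)"
    and "tensor_form st t h1 h2 (t a b) (t a' b') = h1 a a' * h2 b b'"
  using theI'[OF tensor_form_ex1[OF assms]] unfolding tensor_form_def by blast+

lemma tensor_form_eqI:
  assumes "is_tensor_product s1 s2 st t" "bilinear_form s1 h1" "bilinear_form s2 h2"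
    and "bilinear_form st h" "\<And>a b a' b'. h (t a b) (t a' b') = h1 a a' * h2 b b'"
  shows "tensor_form st t h1 h2 = h"
  unfolding tensor_form_def
  by (rule the1_equality[OF tensor_form_ex1[OF assms(1-3)]]) (simp add: assms(4,5))

lemma tensor_mult_eqI:
  assumes "is_tensor_product s1 s2 st t" "bilinear_map s1 s1 s1 m1" "bilinear_map s2 s2 s2 m2"
    and "bilinear_map st st st m" "\<And>a b a' b'. m (t a b) (t a' b') = t (m1 a a') (m2 b b')"
  shows "tensor_mult st t m1 m2 = m"
  unfolding tensor_mult_def
  by (rule the1_equality[OF tensor_mult_ex1[OF assms(1-3)]]) (simp add: assms(4,5))

text \<open>
  Let \<open>z = \<Sum> c i j \<cdot> (i \<otimes> j)\<close> be orthogonal to all pure tensors. Orthogonality to \<open>a \<otimes> b\<close> for all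
  \<open>a\<close> kills \<open>\<Sum> c i j \<cdot> h2 j b\<close> for each \<open>i\<close>, since \<open>h1\<close> is nondegenerate and the \<open>i\<close> are independent.
  Letting \<open>b\<close> vary, the same argument with \<open>h2\<close> kills \<open>c i j\<close>.
\<close>

lemma tensor_form_nondegenerate:
  assumes tp: "is_tensor_product s1 s2 st t"
    and fd1: "finite_dimensional_vector_space s1 B1" and fd2: "finite_dimensional_vector_space s2 B2"
    and h1: "bilinear_form s1 h1" "nondegenerate_form h1"
    and h2: "bilinear_form s2 h2" "nondegenerate_form h2"
  shows "nondegenerate_form (tensor_form st t h1 h2)"
  unfolding nondegenerate_form_def
proof (intro allI impI)
  fix z assume z0: "\<forall>w. tensor_form st t h1 h2 z w = 0"
  interpret V1: finite_dimensional_vector_space s1 B1 by fact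
  interpret V2: finite_dimensional_vector_space s2 B2 by fact
  interpret T: vector_space st using tp by (simp add: is_tensor_product_def)
  obtain \<psi> where "\<And>i j. Vector_Spaces.linear st (*) (\<psi> i j)"
    and "\<And>i j a b. \<psi> i j (t a b) = V1.representation B1 a i * V2.representation B2 b j"
    and z: "\<And>z. z = (\<Sum>(i, j)\<in>B1 \<times> B2. st (\<psi> i j z) (t i j))"
    using tensor_coordinates[OF tp fd1 fd2] by blast
  define c where "c i j = \<psi> i j z" for i j
  have zc: "z = (\<Sum>(i, j)\<in>B1 \<times> B2. st (c i j) (t i j))" unfolding c_def by (rule z)
  have lin1: "Vector_Spaces.linear s1 (*) (\<lambda>x. h1 x a)" for a
    using h1(1) by (simp add: bilinear_map_def)
  have lin2: "Vector_Spaces.linear s2 (*) (\<lambda>x. h2 x b)" for b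
    using h2(1) by (simp add: bilinear_map_def)
  have lin: "Vector_Spaces.linear st (*) (\<lambda>x. tensor_form st t h1 h2 x w)" for w
    using tensor_form_spec(1)[OF tp h1(1) h2(1)] by (simp add: bilinear_map_def)
  have row: "(\<Sum>j\<in>B2. c i j * h2 j b) = 0" if i: "i \<in> B1" for i b
  proof -
    let ?x = "\<Sum>i\<in>B1. s1 (\<Sum>j\<in>B2. c i j * h2 j b) i"
    have "h1 ?x a = 0" for a
    proof -
      interpret L1: Vector_Spaces.linear s1 "(*)" "\<lambda>x. h1 x a" by (rule lin1)
      interpret L: Vector_Spaces.linear st "(*)" "\<lambda>x. tensor_form st t h1 h2 x (t a b)" by (rule lin)
      have "0 = tensor_form st t h1 h2 (\<Sum>(i, j)\<in>B1 \<times> B2. st (c i j) (t i j)) (t a b)"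
        using z0 zc by simp
      also have "\<dots> = (\<Sum>(i, j)\<in>B1 \<times> B2. c i j * (h1 i a * h2 j b))"
        by (simp add: L.sum L.scale tensor_form_spec(2)[OF tp h1(1) h2(1)] split_def)
      also have "\<dots> = (\<Sum>i\<in>B1. (\<Sum>j\<in>B2. c i j * h2 j b) * h1 i a)"
        by (simp only: sum.cartesian_product[symmetric] sum_distrib_right) (simp only: mult_ac)
      also have "\<dots> = h1 ?x a" by (simp add: L1.sum L1.scale)
      finally show ?thesis by simp
    qed
    then have "?x = 0" using h1(2) unfolding nondegenerate_form_def by blast
    from V1.independentD[OF V1.independent_Basis V1.finite_Basis order_refl this i] show ?thesis .
  qed
  have "c i j = 0" if i: "i \<in> B1" and j: "j \<in> B2" for i j
  proof -
    let ?y = "\<Sum>j\<in>B2. s2 (c i j) j"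
    have "h2 ?y b = 0" for b
    proof -
      interpret L2: Vector_Spaces.linear s2 "(*)" "\<lambda>x. h2 x b" by (rule lin2)
      show ?thesis using row[OF i, of b] by (simp add: L2.sum L2.scale)
    qed
    then have "?y = 0" using h2(2) unfolding nondegenerate_form_def by blast
    from V2.independentD[OF V2.independent_Basis V2.finite_Basis order_refl this j] show ?thesis .
  qed
  then have "(\<Sum>(i, j)\<in>B1 \<times> B2. st (c i j) (t i j)) = 0" by (intro sum.neutral) auto
  with zc show "z = 0" by simp
qed

lemma tensor_form_invariant:
  assumes tp: "is_tensor_product s1 s2 st t"
    and m1: "bilinear_map s1 s1 s1 m1" and m2: "bilinear_map s2 s2 s2 m2"
    and h1: "bilinear_form s1 h1" and h2: "bilinear_form s2 h2"
    and inv: "invariant_form m1 h1" "invariant_form m2 h2"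
  shows "invariant_form (tensor_mult st t m1 m2) (tensor_form st t h1 h2)"
proof -
  note m = tensor_mult_spec[OF tp m1 m2] and h = tensor_form_spec[OF tp h1 h2]
  show ?thesis
    unfolding invariant_form_def
  proof (intro allI)
    fix x y z
    let ?m = "tensor_mult st t m1 m2" and ?h = "tensor_form st t h1 h2"
    show "?h (?m x y) z = ?h x (?m y z)"
      by (rule tensor_trilinear_ext[OF tp, where F = "\<lambda>x y z. ?h (?m x y) z" and G = "\<lambda>x y z. ?h x (?m y z)"
            and sw = "(*)"])
        (use m(1) h(1) inv in \<open>simp_all add: m(2) h(2) bilinear_map_iff Vector_Spaces.linear_iff
            invariant_form_def\<close>)
  qed
qed

lemma tensor_form_symmetric:
  assumes tp: "is_tensor_product s1 s2 st t"
    and h1: "bilinear_form s1 h1" and h2: "bilinear_form s2 h2"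
    and sym: "\<And>x y. h1 x y = h1 y x" "\<And>x y. h2 x y = h2 y x"
  shows "tensor_form st t h1 h2 x y = tensor_form st t h1 h2 y x"
proof -
  note h = tensor_form_spec[OF tp h1 h2]
  have "tensor_form st t h1 h2 = (\<lambda>x y. tensor_form st t h1 h2 y x)"
  proof (rule tensor_form_eqI[OF tp h1 h2])
    show "bilinear_form st (\<lambda>x y. tensor_form st t h1 h2 y x)"
      using h(1) by (simp add: bilinear_map_def)
    show "tensor_form st t h1 h2 (t a' b') (t a b) = h1 a a' * h2 b b'" for a b a' b'
      unfolding h(2) by (rule arg_cong2[where f = "(*)", OF sym])
  qed
  then show ?thesis by metis
qed

text \<open>
  Commutativity is only required of the two products together, so that the lemma covers a pair of
  commutative and a pair of anticommutative algebras alike.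
\<close>

lemma tensor_comm_algebra:
  assumes tp: "is_tensor_product s1 s2 st t"
    and A1: "fd_algebra s1 m1" and A2: "fd_algebra s2 m2"
    and comm: "\<And>a a' b b'. t (m1 a a') (m2 b b') = t (m1 a' a) (m2 b' b)"
  shows "comm_algebra st (tensor_mult st t m1 m2)"
proof -
  interpret A1: fd_algebra s1 m1 by fact
  interpret A2: fd_algebra s2 m2 by fact
  interpret T: vector_space st using tp by (simp add: is_tensor_product_def)
  note m = tensor_mult_spec[OF tp A1.bilinear_mult A2.bilinear_mult]
  show ?thesis
  proof unfold_locales
    show "\<exists>B. finite_dimensional_vector_space st B"
      using A1.finite_dimensional A2.finite_dimensional tensor_basis(2)[OF tp] by blast
    show "bilinear_map st st st (tensor_mult st t m1 m2)" by (rule m(1))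
    have "tensor_mult st t m1 m2 = (\<lambda>x y. tensor_mult st t m1 m2 y x)"
    proof (rule tensor_mult_eqI[OF tp A1.bilinear_mult A2.bilinear_mult])
      show "bilinear_map st st st (\<lambda>x y. tensor_mult st t m1 m2 y x)"
        using m(1) by (simp add: bilinear_map_def)
      show "tensor_mult st t m1 m2 (t a' b') (t a b) = t (m1 a a') (m2 b b')" for a b a' b'
        unfolding m(2) by (rule comm)
    qed
    then show "tensor_mult st t m1 m2 x y = tensor_mult st t m1 m2 y x" for x y by metis
  qed
qed

context fd_algebra
begin

lemma mult_linear: "Vector_Spaces.linear scale scale (mult x)"
  using bilinear_mult by (simp add: bilinear_map_def)

lemma mult_add_scale:
  "mult (x + y) z = mult x z + mult y z" "mult (scale c x) z = scale c (mult x z)"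
  "mult x (y + z) = mult x y + mult x z" "mult x (scale c z) = scale c (mult x z)"
  using bilinear_mult by (simp_all add: bilinear_map_iff)

lemma mult_mult_linear: "Vector_Spaces.linear scale scale (\<lambda>v. mult x (mult y v))"
  using Vector_Spaces.linear_compose[OF mult_linear mult_linear] by (simp add: comp_def)

lemma lin_trace_mult_linear: "Vector_Spaces.linear scale (*) (\<lambda>x. lin_trace scale (mult x))"
proof -
  obtain B where B: "finite_dimensional_vector_space scale B" using finite_dimensional by blast
  have "mult (x + y) = (\<lambda>v. mult x v + mult y v)" "mult (scale c x) = (\<lambda>v. scale c (mult x v))" for x y c
    by (simp_all add: mult_add_scale fun_eq_iff)
  then show ?thesis
    by (simp add: Vector_Spaces.linear_iff vector_space_axioms vector_space_mult
        lin_trace_add_diff(1)[OF B mult_linear mult_linear] lin_trace_scale[OF B mult_linear])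
qed

lemma killing_form_symmetric: "killing_form scale mult x y = killing_form scale mult y x"
  using finite_dimensional lin_trace_commute[OF _ mult_linear mult_linear]
  unfolding killing_form_def by blast

lemma killing_form_bilinear: "bilinear_form scale (killing_form scale mult)"
proof -
  obtain B where B: "finite_dimensional_vector_space scale B" using finite_dimensional by blast
  have "mult (x + y) \<circ> mult z = (\<lambda>v. mult x (mult z v) + mult y (mult z v))"
    "mult (scale c x) \<circ> mult z = (\<lambda>v. scale c (mult x (mult z v)))" for x y z c
    by (simp_all add: mult_add_scale fun_eq_iff)
  then have "Vector_Spaces.linear scale (*) (\<lambda>x. killing_form scale mult x z)" for z
    by (simp add: Vector_Spaces.linear_iff vector_space_axioms vector_space_mult killing_form_def
        lin_trace_add_diff(1)[OF B mult_mult_linear mult_mult_linear]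
        lin_trace_scale[OF B mult_mult_linear] comp_def)
  moreover have "killing_form scale mult x = (\<lambda>y. killing_form scale mult y x)" for x
    using killing_form_symmetric by blast
  ultimately show ?thesis unfolding bilinear_map_def by metis
qed

end

lemma tensor_exact:
  assumes tp: "is_tensor_product s1 s2 st t"
    and A1: "fd_algebra s1 m1" and A2: "fd_algebra s2 m2"
    and comm: "comm_algebra st (tensor_mult st t m1 m2)"
    and tr: "(\<forall>x. lin_trace s1 (m1 x) = 0) \<or> (\<forall>x. lin_trace s2 (m2 x) = 0)"
  shows "exact_comm_algebra st (tensor_mult st t m1 m2)"
proof -
  interpret A1: fd_algebra s1 m1 by fact
  interpret A2: fd_algebra s2 m2 by fact
  interpret C: comm_algebra st "tensor_mult st t m1 m2" by fact
  obtain B1 B2 where B: "finite_dimensional_vector_space s1 B1" "finite_dimensional_vector_space s2 B2"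
    using A1.finite_dimensional A2.finite_dimensional by blast
  note m = tensor_mult_spec[OF tp A1.bilinear_mult A2.bilinear_mult]
  have "lin_trace st (tensor_mult st t m1 m2 x) = 0" for x
  proof (rule tensor_linear_ext[OF tp C.lin_trace_mult_linear, where g' = "\<lambda>_. 0"])
    show "Vector_Spaces.linear st (*) (\<lambda>_. 0 :: 'a)"
      by (simp add: Vector_Spaces.linear_iff C.vector_space_axioms vector_space_mult)
    fix a b
    have "lin_trace st (tensor_mult st t m1 m2 (t a b)) = lin_trace s1 (m1 a) * lin_trace s2 (m2 b)"
      by (rule lin_trace_tensor[OF tp B A1.mult_linear A2.mult_linear C.mult_linear])
        (rule m(2))
    also have "\<dots> = 0" using tr by (elim disjE) simp_all
    finally show "lin_trace st (tensor_mult st t m1 m2 (t a b)) = 0" .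
  qed
  then show ?thesis by unfold_locales
qed

lemma tensor_killing_form:
  assumes tp: "is_tensor_product s1 s2 st t"
    and A1: "fd_algebra s1 m1" and A2: "fd_algebra s2 m2"
    and comm: "comm_algebra st (tensor_mult st t m1 m2)"
  shows "killing_form st (tensor_mult st t m1 m2)
    = tensor_form st t (killing_form s1 m1) (killing_form s2 m2)"
proof -
  interpret A1: fd_algebra s1 m1 by fact
  interpret A2: fd_algebra s2 m2 by fact
  interpret C: comm_algebra st "tensor_mult st t m1 m2" by fact
  obtain B1 B2 where B: "finite_dimensional_vector_space s1 B1" "finite_dimensional_vector_space s2 B2"
    using A1.finite_dimensional A2.finite_dimensional by blast
  note m = tensor_mult_spec[OF tp A1.bilinear_mult A2.bilinear_mult]
  have "killing_form st (tensor_mult st t m1 m2) (t a b) (t a' b')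
      = killing_form s1 m1 a a' * killing_form s2 m2 b b'" for a b a' b'
    unfolding killing_form_def comp_def
    by (rule lin_trace_tensor[OF tp B A1.mult_mult_linear A2.mult_mult_linear C.mult_mult_linear])
      (simp add: m(2))
  from tensor_form_eqI[OF tp A1.killing_form_bilinear A2.killing_form_bilinear
      C.killing_form_bilinear this]
  show ?thesis by simp
qed

lemma tensor_metrized:
  assumes tp: "is_tensor_product s1 s2 st t"
    and A1: "fd_algebra s1 m1" and A2: "fd_algebra s2 m2"
    and comm: "comm_algebra st (tensor_mult st t m1 m2)"
    and h1: "bilinear_form s1 h1" "\<And>x y. h1 x y = h1 y x" "nondegenerate_form h1" "invariant_form m1 h1"
    and h2: "bilinear_form s2 h2" "\<And>x y. h2 x y = h2 y x" "nondegenerate_form h2" "invariant_form m2 h2"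
  shows "metrized_comm_algebra st (tensor_mult st t m1 m2) (tensor_form st t h1 h2)"
proof -
  interpret A1: fd_algebra s1 m1 by fact
  interpret A2: fd_algebra s2 m2 by fact
  interpret C: comm_algebra st "tensor_mult st t m1 m2" by fact
  obtain B1 B2 where B: "finite_dimensional_vector_space s1 B1" "finite_dimensional_vector_space s2 B2"
    using A1.finite_dimensional A2.finite_dimensional by blast
  show ?thesis
  proof unfold_locales
    show "bilinear_form st (tensor_form st t h1 h2)" by (rule tensor_form_spec(1)[OF tp h1(1) h2(1)])
    show "tensor_form st t h1 h2 x y = tensor_form st t h1 h2 y x" for x y
      by (rule tensor_form_symmetric[OF tp h1(1) h2(1) h1(2) h2(2)])
    show "nondegenerate_form (tensor_form st t h1 h2)"
      by (rule tensor_form_nondegenerate[OF tp B h1(1,3) h2(1,3)])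
    show "invariant_form (tensor_mult st t m1 m2) (tensor_form st t h1 h2)"
      by (rule tensor_form_invariant[OF tp A1.bilinear_mult A2.bilinear_mult h1(1) h2(1) h1(4) h2(4)])
  qed
qed

section \<open>Generalized eigenvectors\<close>

text \<open>
  The operator \<open>T\<close> acts on a space that may be infinite-dimensional; finiteness is imposed on the
  invariant subspaces in question. The results are used twice: for an operator, and for the
  commutator with it on a space of operators.
\<close>

locale linear_endo = vector_space scale
  for scale :: "'k::field \<Rightarrow> 'v::ab_group_add \<Rightarrow> 'v" +
  fixes T :: "'v \<Rightarrow> 'v"
  assumes T_add: "T (u + v) = T u + T v"
    and T_scale: "T (scale c u) = scale c (T u)"
begin

lemma T_0 [simp]: "T 0 = 0"
  using T_scale[of 0 0] by simp

lemma T_diff: "T (u - v) = T u - T v"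
  using T_add[of "u - v" v] by (simp add: algebra_simps)

definition shift :: "'k \<Rightarrow> 'v \<Rightarrow> 'v"
  where "shift c v = T v - scale c v"

lemma shift_add: "shift c (u + v) = shift c u + shift c v"
  and shift_diff: "shift c (u - v) = shift c u - shift c v"
  and shift_scale: "shift c (scale a v) = scale a (shift c v)"
  and shift_0 [simp]: "shift c 0 = 0"
  by (simp_all add: shift_def T_add T_diff T_scale algebra_simps mult.commute)

lemma shift_commute: "shift a (shift b v) = shift b (shift a v)"
  by (simp add: shift_def T_diff T_scale algebra_simps mult.commute)

definition gen_eig :: "'k \<Rightarrow> 'v \<Rightarrow> bool"
  where "gen_eig c v \<longleftrightarrow> (\<exists>k. (shift c ^^ k) v = 0)"

lemma shift_pow_0 [simp]: "(shift c ^^ k) 0 = 0"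
  by (induction k) auto

lemma shift_pow_add: "(shift c ^^ k) (u + v) = (shift c ^^ k) u + (shift c ^^ k) v"
  and shift_pow_scale: "(shift c ^^ k) (scale a v) = scale a ((shift c ^^ k) v)"
  by (induction k) (auto simp: shift_add shift_scale)

lemma shift_pow_commute: "(shift c ^^ k) (shift a v) = shift a ((shift c ^^ k) v)"
  by (induction k) (auto simp: shift_commute)

lemma shift_pow_mono: "(shift c ^^ k) v = 0 \<Longrightarrow> k \<le> l \<Longrightarrow> (shift c ^^ l) v = 0"
  using funpow_add[of "l - k" k "shift c"] by simp

lemma gen_eig_0 [simp]: "gen_eig c 0"
  by (simp add: gen_eig_def)

lemma gen_eig_add: "gen_eig c u \<Longrightarrow> gen_eig c v \<Longrightarrow> gen_eig c (u + v)"
  unfolding gen_eig_def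
proof (elim exE)
  fix k l assume "(shift c ^^ k) u = 0" "(shift c ^^ l) v = 0"
  then show "\<exists>k. (shift c ^^ k) (u + v) = 0"
    by (intro exI[of _ "max k l"])
      (simp add: shift_pow_add shift_pow_mono[of k _ u "max k l"] shift_pow_mono[of l _ v "max k l"])
qed

lemma gen_eig_scale: "gen_eig c u \<Longrightarrow> gen_eig c (scale a u)"
  unfolding gen_eig_def by (auto simp: shift_pow_scale)

lemma subspace_gen_eig: "subspace {v. gen_eig c v}"
  by (simp add: subspace_def gen_eig_add gen_eig_scale)

lemma gen_eig_shift: "gen_eig c u \<Longrightarrow> gen_eig c (shift a u)"
  unfolding gen_eig_def by (metis shift_pow_commute shift_0)

lemma gen_eig_shift_iff: "gen_eig c (shift c u) \<longleftrightarrow> gen_eig c u"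
  by (metis gen_eig_def gen_eig_shift funpow_Suc_right o_apply)

lemma gen_eig_induct [consumes 1, case_names zero shift]:
  assumes "gen_eig c u" and "P 0"
    and "\<And>u. gen_eig c u \<Longrightarrow> P (shift c u) \<Longrightarrow> P u"
  shows "P u"
proof -
  from assms(1) obtain k where "(shift c ^^ k) u = 0" by (auto simp: gen_eig_def)
  then show ?thesis
  proof (induction k arbitrary: u)
    case 0 then show ?case using assms(2) by simp
  next
    case (Suc k)
    have "(shift c ^^ k) (shift c u) = 0" using Suc.prems by (simp only: funpow_Suc_right o_apply)
    then have "P (shift c u)" by (rule Suc.IH)
    moreover have "gen_eig c u" using Suc.prems unfolding gen_eig_def by blast
    ultimately show ?case by (metis assms(3))
  qed
qed

text \<open>
  Away from the eigenvalue \<open>a\<close>, \<open>T - a\<close> is invertible. The solution is found by induction on the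
  order of \<open>u\<close>: if \<open>w\<close> solves the equation for \<open>(T - c) u\<close>, then \<open>(u - w) / (c - a)\<close> solves it for \<open>u\<close>,
  because \<open>(T - a) u - (T - c) u = (c - a) u\<close>.
\<close>

lemma gen_eig_solve:
  assumes "gen_eig c u" "c \<noteq> a" "u \<in> W" "subspace W" "\<And>w. w \<in> W \<Longrightarrow> T w \<in> W"
  shows "\<exists>w\<in>W. gen_eig c w \<and> shift a w = u"
  using assms(1,3)
proof (induction rule: gen_eig_induct)
  case zero
  then show ?case by (intro bexI[of _ 0]) auto
next
  case (shift u)
  have "shift c u \<in> W"
    unfolding shift_def using shift.prems assms(4,5) by (simp add: subspace_diff subspace_scale)
  then obtain w where w: "w \<in> W" "gen_eig c w" "shift a w = shift c u" using shift.IH by blast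
  define w' where "w' = scale (inverse (c - a)) (u - w)"
  have "gen_eig c (u - w)"
    using gen_eig_add[OF shift.hyps gen_eig_scale[OF w(2), of "-1"]] by simp
  then have gw: "gen_eig c w'" unfolding w'_def by (rule gen_eig_scale)
  have wW: "w' \<in> W" unfolding w'_def
    using shift.prems w(1) assms(4) by (simp add: subspace_diff subspace_scale)
  have "shift a (u - w) = scale (c - a) u"
    by (simp only: shift_diff w(3)) (simp add: shift_def scale_left_diff_distrib)
  then have "shift a w' = u" using assms(2) by (simp add: w'_def shift_scale)
  then show ?case using gw wW by (intro bexI[of _ w'] conjI)
qed

lemma gen_eig_not_eigenvector:
  assumes "gen_eig c u" "shift a u = 0" "c \<noteq> a"
  shows "u = 0"
  using assms(1,2)
proof (induction rule: gen_eig_induct)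
  case (shift u)
  have "shift a (shift c u) = 0" using shift.prems shift_commute[of a c u] by simp
  then have "shift c u = 0" by (rule shift.IH)
  moreover have "scale (c - a) u = shift a u - shift c u"
    by (simp add: shift_def scale_left_diff_distrib)
  ultimately have "scale (c - a) u = 0" using shift.prems by simp
  then show ?case using assms(3) by (simp only: scale_eq_0_iff eq_iff_diff_eq_0[of c a] simp_thms)
qed simp

lemma gen_eig_unique:
  assumes "gen_eig c u" "gen_eig a u" "c \<noteq> a"
  shows "u = 0"
  using assms(2,1)
proof (induction rule: gen_eig_induct)
  case (shift u)
  have "shift a u = 0" by (rule shift.IH[OF gen_eig_shift[OF shift.prems]])
  then show ?case by (rule gen_eig_not_eigenvector[OF shift.prems _ assms(3)])
qed simp

text \<open>
  Generalized eigenspaces of distinct eigenvalues form a direct sum: a power of \<open>T - a\<close> removes the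
  summand for \<open>a\<close> and leaves, by induction, summands that it kills as well; these vanish by
  \<open>gen_eig_unique\<close>.
\<close>

lemma gen_eig_sum_zero:
  assumes "finite C" "\<And>c. c \<in> C \<Longrightarrow> gen_eig c (f c)" "(\<Sum>c\<in>C. f c) = 0" "c \<in> C"
  shows "f c = 0"
  using assms
proof (induction C arbitrary: f c rule: finite_induct)
  case (insert a C)
  have sum_shift: "(shift a ^^ k) (\<Sum>c\<in>C. f c) = (\<Sum>c\<in>C. (shift a ^^ k) (f c))" for k
    using \<open>finite C\<close> by (induction C rule: finite_induct) (auto simp: shift_pow_add)
  from insert.prems(1)[of a] obtain k where k: "(shift a ^^ k) (f a) = 0" by (auto simp: gen_eig_def)
  have "(shift a ^^ k) (f a + (\<Sum>c\<in>C. f c)) = 0" using insert by simp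
  then have s0: "(\<Sum>c\<in>C. (shift a ^^ k) (f c)) = 0" by (simp add: shift_pow_add k sum_shift)
  have g: "gen_eig c ((shift a ^^ k) (f c))" if "c \<in> C" for c
    using insert.prems(1)[of c] that by (induction k) (auto simp: gen_eig_shift)
  have C0: "f c = 0" if c: "c \<in> C" for c
  proof -
    have "(shift a ^^ k) (f c) = 0" by (rule insert.IH[OF g s0 c])
    then have "gen_eig a (f c)" by (auto simp: gen_eig_def)
    moreover have "gen_eig c (f c)" "c \<noteq> a" using insert c by auto
    ultimately show ?thesis using gen_eig_unique by metis
  qed
  then have "f a = 0" using insert.prems(2) insert.hyps by simp
  with C0 insert.prems(3) show ?case by auto
qed simp

definition apply_poly :: "'k poly \<Rightarrow> 'v \<Rightarrow> 'v"
  where "apply_poly p v = (\<Sum>i\<le>degree p. scale (poly.coeff p i) ((T ^^ i) v))"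

lemma apply_poly_bound: "degree p \<le> n \<Longrightarrow> apply_poly p v = (\<Sum>i\<le>n. scale (poly.coeff p i) ((T ^^ i) v))"
  unfolding apply_poly_def by (rule sum.mono_neutral_left) (auto simp: coeff_eq_0)

lemma T_pow_add: "(T ^^ i) (u + v) = (T ^^ i) u + (T ^^ i) v"
  and T_pow_scale: "(T ^^ i) (scale c u) = scale c ((T ^^ i) u)"
  by (induction i) (auto simp: T_add T_scale)

lemma apply_poly_linear_factor: "apply_poly ([:- c, 1:] * q) v = apply_poly q (shift c v)"
proof -
  let ?n = "Suc (degree q)"
  have "degree ([:- c, 1:] * q) \<le> ?n"
    by (rule order_trans[OF degree_mult_le]) simp
  then have "apply_poly ([:- c, 1:] * q) v
      = (\<Sum>i\<le>?n. scale (poly.coeff ([:- c, 1:] * q) i) ((T ^^ i) v))"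
    by (rule apply_poly_bound)
  also have "[:- c, 1:] * q = pCons 0 q - smult c q" by simp
  also have "(\<Sum>i\<le>?n. scale (poly.coeff (pCons 0 q - smult c q) i) ((T ^^ i) v))
      = (\<Sum>i\<le>?n. scale (poly.coeff (pCons 0 q) i) ((T ^^ i) v))
      - (\<Sum>i\<le>?n. scale (c * poly.coeff q i) ((T ^^ i) v))"
    by (simp only: coeff_diff coeff_smult scale_left_diff_distrib sum_subtractf)
  also have "(\<Sum>i\<le>?n. scale (poly.coeff (pCons 0 q) i) ((T ^^ i) v))
      = (\<Sum>i\<le>degree q. scale (poly.coeff q i) ((T ^^ i) (T v)))"
    by (subst sum.atMost_Suc_shift) (simp add: funpow_swap1)
  also have "(\<Sum>i\<le>?n. scale (c * poly.coeff q i) ((T ^^ i) v))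
      = (\<Sum>i\<le>degree q. scale (c * poly.coeff q i) ((T ^^ i) v))"
    by (simp add: coeff_eq_0)
  finally have "apply_poly (pCons 0 q - smult c q) v = (\<Sum>i\<le>degree q.
      scale (poly.coeff q i) ((T ^^ i) (T v)) - scale (c * poly.coeff q i) ((T ^^ i) v))"
    by (simp only: sum_subtractf)
  also have "\<dots> = (\<Sum>i\<le>degree q. scale (poly.coeff q i) ((T ^^ i) (shift c v)))"
  proof (rule sum.cong[OF refl])
    fix i
    have "(T ^^ i) (T v) = (T ^^ i) (shift c v) + scale c ((T ^^ i) v)"
      using T_pow_add[of i "shift c v" "scale c v"] by (simp add: shift_def T_pow_scale)
    then show "scale (poly.coeff q i) ((T ^^ i) (T v)) - scale (c * poly.coeff q i) ((T ^^ i) v)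
        = scale (poly.coeff q i) ((T ^^ i) (shift c v))"
      by (simp add: scale_right_distrib mult.commute)
  qed
  finally show ?thesis by (simp add: apply_poly_def)
qed

text \<open>
  The iterates of \<open>w\<close> stay in a finite-dimensional space, so one of them is a combination of the
  earlier ones.
\<close>

lemma annihilating_poly_exists:
  assumes "finite F" "\<And>i. (T ^^ i) w \<in> span F"
  shows "\<exists>p. p \<noteq> 0 \<and> apply_poly p w = 0"
proof -
  define t where "t i = (T ^^ i) w" for i
  have "\<exists>k. t k \<in> span (t ` {..<k})"
  proof (rule ccontr)
    assume no: "\<nexists>k. t k \<in> span (t ` {..<k})"
    have "independent (t ` {..<k}) \<and> card (t ` {..<k}) = k" for k
    proof (induction k)
      case (Suc k)
      have "t k \<notin> t ` {..<k}" using no span_base[of "t k" "t ` {..<k}"] by auto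
      then show ?case using no Suc by (simp add: lessThan_Suc independent_insert)
    qed (simp add: independent_empty)
    moreover have "t ` {..<Suc (card F)} \<subseteq> span F" using assms(2) by (auto simp: t_def)
    ultimately have "Suc (card F) \<le> card F"
      using independent_span_bound[OF assms(1)] by metis
    then show False by simp
  qed
  then obtain k where k: "t k \<in> span (t ` {..<k})" ..
  have "span (t ` {..<k}) \<subseteq> {\<Sum>i<k. scale (c i) (t i) |c. True}"
  proof (rule span_minimal)
    show "t ` {..<k} \<subseteq> {\<Sum>i<k. scale (c i) (t i) |c. True}"
    proof clarsimp
      fix j assume "j < k"
      have "(\<Sum>i<k. scale (if i = j then 1 else 0) (t i)) = (\<Sum>i<k. if i = j then t i else 0)"
        by (intro sum.cong) auto
      then have "t j = (\<Sum>i<k. scale (if i = j then 1 else 0) (t i))" using \<open>j < k\<close> by simp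
      then show "\<exists>c. t j = (\<Sum>i<k. scale (c i) (t i))"
        by (intro exI[of _ "\<lambda>i. if i = j then 1 else 0"])
    qed
    show "subspace {\<Sum>i<k. scale (c i) (t i) |c. True}"
    proof (rule subspaceI)
      show "0 \<in> {\<Sum>i<k. scale (c i) (t i) |c. True}" by (auto intro: exI[of _ "\<lambda>_. 0"])
    next
      fix x y assume "x \<in> {\<Sum>i<k. scale (c i) (t i) |c. True}" "y \<in> {\<Sum>i<k. scale (c i) (t i) |c. True}"
      then obtain c d where "x = (\<Sum>i<k. scale (c i) (t i))" "y = (\<Sum>i<k. scale (d i) (t i))" by auto
      then have "x + y = (\<Sum>i<k. scale (c i + d i) (t i))"
        by (simp add: scale_left_distrib sum.distrib)
      then show "x + y \<in> {\<Sum>i<k. scale (c i) (t i) |c. True}" by (auto intro: exI[of _ "\<lambda>i. c i + d i"])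
    next
      fix a x assume "x \<in> {\<Sum>i<k. scale (c i) (t i) |c. True}"
      then obtain c where "x = (\<Sum>i<k. scale (c i) (t i))" by auto
      then have "scale a x = (\<Sum>i<k. scale (a * c i) (t i))" by (simp add: scale_sum_right)
      then show "scale a x \<in> {\<Sum>i<k. scale (c i) (t i) |c. True}" by (auto intro: exI[of _ "\<lambda>i. a * c i"])
    qed
  qed
  from subsetD[OF this k] obtain c where c: "t k = (\<Sum>i<k. scale (c i) (t i))"
    unfolding mem_Collect_eq by (elim exE conjE)
  define p where "p = Polynomial.monom 1 k - (\<Sum>i<k. Polynomial.monom (c i) i)"
  have co: "poly.coeff p i = (if i = k then 1 else if i < k then - c i else 0)" for i
    by (auto simp: p_def coeff_sum)
  have "p \<noteq> 0" using co[of k] by auto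
  moreover have "apply_poly p w = 0"
  proof -
    have "degree p \<le> k" by (rule degree_le) (auto simp: co)
    then have "apply_poly p w = (\<Sum>i\<le>k. scale (poly.coeff p i) (t i))" unfolding t_def by (rule apply_poly_bound)
    also have "\<dots> = t k + (\<Sum>i<k. scale (- c i) (t i))"
      by (simp add: lessThan_Suc_atMost[symmetric] co del: scale_minus_left)
    finally show ?thesis by (simp add: c sum_negf)
  qed
  ultimately show ?thesis by blast
qed

text \<open>
  The equation \<open>(T - a) w = u\<close> can be solved up to a generalized eigenvector for \<open>a\<close>: the components
  of \<open>u\<close> for other eigenvalues have exact preimages, and the component for \<open>a\<close> is the error.
\<close>

lemma span_gen_eig_shift_solve:
  assumes W: "subspace W" "\<And>w. w \<in> W \<Longrightarrow> T w \<in> W"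
    and u: "u \<in> span {u\<in>W. \<exists>c. gen_eig c u}"
  shows "\<exists>w \<in> W \<inter> span {u\<in>W. \<exists>c. gen_eig c u}. gen_eig a (u - shift a w)"
  using u
proof (induction rule: span_induct_alt)
  case base
  show ?case by (intro bexI[of _ 0]) (auto simp: span_zero subspace_0[OF W(1)])
next
  case (step e x y)
  then obtain c where x: "x \<in> W" "gen_eig c x" by auto
  let ?G = "{u\<in>W. \<exists>c. gen_eig c u}"
  have 1: "\<exists>w \<in> W \<inter> span ?G. gen_eig a (x - shift a w)"
  proof (cases "c = a")
    case True
    then show ?thesis using x by (intro bexI[of _ 0]) (auto simp: span_zero subspace_0[OF W(1)])
  next
    case False
    from gen_eig_solve[OF x(2) False x(1) W] obtain w where "w \<in> W" "gen_eig c w" "shift a w = x" by blast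
    then show ?thesis by (intro bexI[of _ w]) (auto intro: span_base)
  qed
  then obtain w1 where w1: "w1 \<in> W" "w1 \<in> span ?G" "gen_eig a (x - shift a w1)" by blast
  from step obtain w2 where w2: "w2 \<in> W" "w2 \<in> span ?G" "gen_eig a (y - shift a w2)" by blast
  have "gen_eig a (scale e (x - shift a w1) + (y - shift a w2))"
    by (intro gen_eig_add gen_eig_scale w1 w2)
  then have "gen_eig a (scale e x + y - shift a (scale e w1 + w2))"
    by (simp add: shift_add shift_scale algebra_simps)
  then show ?case using w1 w2 W(1)
    by (intro bexI[of _ "scale e w1 + w2"]) (auto intro: span_add span_scale subspace_add subspace_scale)
qed

end

text \<open>
  Induction on the degree of the annihilating polynomial. Splitting off a root \<open>c\<close>, the induction
  hypothesis applies to \<open>(T - c) w\<close>; a solution \<open>v\<close> of \<open>(T - c) v = (T - c) w\<close> up to a generalized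
  eigenvector for \<open>c\<close> differs from \<open>w\<close> by a generalized eigenvector for \<open>c\<close>.
\<close>

theorem (in linear_endo) span_gen_eig_annihilated:
  fixes p :: "'k poly"
  assumes ac: "\<And>p::'k poly. degree p > 0 \<Longrightarrow> \<exists>c. poly p c = 0"
    and W: "subspace W" "\<And>w. w \<in> W \<Longrightarrow> T w \<in> W"
  shows "p \<noteq> 0 \<Longrightarrow> apply_poly p w = 0 \<Longrightarrow> w \<in> W \<Longrightarrow> w \<in> span {u\<in>W. \<exists>c. gen_eig c u}"
proof (induction "degree p" arbitrary: p w)
  case 0
  then obtain a where "p = [:a:]" by (metis degree_eq_zeroE)
  with 0 have "w = 0" by (simp add: apply_poly_def)
  then show ?case by (simp add: span_zero)
next
  case (Suc n)
  then obtain c where "poly p c = 0" using ac[of p] by auto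
  then obtain q where p: "p = [:- c, 1:] * q" by (auto simp: poly_eq_0_iff_dvd)
  with Suc.prems have q: "q \<noteq> 0" by auto
  have "n = degree q" using Suc.hyps(2) q unfolding p by (subst (asm) degree_mult_eq) auto
  moreover have "shift c w \<in> W" unfolding shift_def using Suc.prems W
    by (simp add: subspace_diff subspace_scale)
  moreover have "apply_poly q (shift c w) = 0" using Suc.prems(2) by (simp only: p apply_poly_linear_factor)
  ultimately have "shift c w \<in> span {u\<in>W. \<exists>c. gen_eig c u}" using Suc.hyps(1) q by blast
  from span_gen_eig_shift_solve[OF W this, of c] obtain v where
    v: "v \<in> W" "v \<in> span {u\<in>W. \<exists>c. gen_eig c u}" "gen_eig c (shift c w - shift c v)" by blast
  have "gen_eig c (w - v)" using v(3) by (simp add: gen_eig_shift_iff flip: shift_diff)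
  moreover have "w - v \<in> W" using Suc.prems v W by (simp add: subspace_diff)
  ultimately have "w - v \<in> span {u\<in>W. \<exists>c. gen_eig c u}" by (auto intro: span_base)
  from span_add[OF this v(2)] show ?case by simp
qed

theorem span_gen_eig:
  fixes scale :: "'k::alg_closed_field \<Rightarrow> 'v::ab_group_add \<Rightarrow> 'v"
  assumes "linear_endo scale T" "finite F" "W \<subseteq> Modules.module.span scale F"
    "Modules.module.subspace scale W" "\<And>w. w \<in> W \<Longrightarrow> T w \<in> W" "w \<in> W"
  shows "w \<in> Modules.module.span scale {u\<in>W. \<exists>c. linear_endo.gen_eig scale T c u}"
proof -
  interpret linear_endo scale T by fact
  have "(T ^^ i) w \<in> W" for i using assms(5,6) by (induction i) auto
  then have "(T ^^ i) w \<in> span F" for i using assms(3) by blast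
  from annihilating_poly_exists[OF assms(2) this] obtain p where "p \<noteq> 0" "apply_poly p w = 0" by blast
  from span_gen_eig_annihilated[OF _ assms(4,5) this assms(6)]
  show ?thesis using alg_closed_imp_poly_has_root by metis
qed

text \<open>
  A basis of generalized eigenvectors in which \<open>T\<close> has its eigenvalues on the diagonal, so that the
  trace of \<open>T\<close> composed with an operator diagonal in this basis can be read off. It is grown one
  vector at a time: a generalized eigenvector outside the span of the vectors chosen so far is
  multiplied by \<open>T - c\<close> until one more factor would move it into that span.
\<close>

lemma (in linear_endo) triangular_gen_eigenbasis:
  assumes U: "subspace U" and F: "finite F" "U \<subseteq> span F"
    and TU: "\<And>u. u \<in> U \<Longrightarrow> T u \<in> U"
    and G: "U \<subseteq> span {u\<in>U. \<exists>c. gen_eig c u}"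
  obtains B l where "finite B" "independent B" "span B = U"
    and "\<And>b. b \<in> B \<Longrightarrow> gen_eig (l b) b"
    and "\<And>b. b \<in> B \<Longrightarrow> representation B (T b) b = l b"
proof -
  let ?P = "\<lambda>S. S \<subseteq> U \<and> finite S \<and> independent S \<and>
    (\<exists>l. \<forall>b\<in>S. gen_eig (l b) b \<and> shift (l b) b \<in> span S \<and> representation S (shift (l b) b) b = 0)"
  have "?P {}" by (simp add: independent_empty)
  moreover have "\<forall>S. ?P S \<longrightarrow> card S < Suc (card F)"
    using independent_span_bound[OF F(1)] F(2) by (meson le_imp_less_Suc order_trans)
  ultimately obtain B where B: "?P B" and max: "\<And>S. ?P S \<Longrightarrow> card S \<le> card B"
    using ex_has_greatest_nat[of ?P "{}" card "Suc (card F)"] by blast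
  then obtain l where l: "\<And>b. b \<in> B \<Longrightarrow> gen_eig (l b) b" "\<And>b. b \<in> B \<Longrightarrow> shift (l b) b \<in> span B"
    "\<And>b. b \<in> B \<Longrightarrow> representation B (shift (l b) b) b = 0" by blast
  have le: "span B \<subseteq> U" using B U by (intro span_minimal) auto
  have "U \<subseteq> span B"
  proof (rule ccontr)
    assume "\<not> U \<subseteq> span B"
    then have "\<not> {u\<in>U. \<exists>c. gen_eig c u} \<subseteq> span B"
      using G span_minimal[OF _ subspace_span] by blast
    then obtain u c where u: "u \<in> U" "gen_eig c u" "u \<notin> span B" by blast
    have shiftU: "shift c v \<in> U" if "v \<in> U" for v
      unfolding shift_def using that TU U by (simp add: subspace_diff subspace_scale)
    have "\<exists>b\<in>U. gen_eig c b \<and> b \<notin> span B \<and> shift c b \<in> span B"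
      using u(2,1,3)
    proof (induction rule: gen_eig_induct)
      case zero then show ?case by (simp add: span_zero)
    next
      case (shift u) then show ?case using shiftU by blast
    qed
    then obtain b where b: "b \<in> U" "gen_eig c b" "b \<notin> span B" "shift c b \<in> span B" by blast
    then have nB: "b \<notin> B" using span_base by blast
    have ind: "independent (insert b B)" using B b by (simp add: independent_insert)
    have rep: "representation (insert b B) v = representation B v" if "v \<in> span B" for v
      using that by (intro representation_extend[OF ind]) auto
    have sub: "span B \<subseteq> span (insert b B)" by (intro span_mono) auto
    have "\<forall>a\<in>insert b B. gen_eig ((l(b := c)) a) a \<and> shift ((l(b := c)) a) a \<in> span (insert b B)
        \<and> representation (insert b B) (shift ((l(b := c)) a) a) a = 0"
    proof
      fix a assume a: "a \<in> insert b B"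
      show "gen_eig ((l(b := c)) a) a \<and> shift ((l(b := c)) a) a \<in> span (insert b B)
        \<and> representation (insert b B) (shift ((l(b := c)) a) a) a = 0"
      proof (cases "a = b")
        case True
        have "representation B (shift c b) b = 0" using nB representation_ne_zero by blast
        with True b sub show ?thesis by (auto simp: rep)
      next
        case False
        with a l[of a] sub show ?thesis by (auto simp: rep)
      qed
    qed
    then have "?P (insert b B)" using B b ind by blast
    from max[OF this] show False using B nB by simp
  qed
  with le have span: "span B = U" by blast
  have "representation B (T b) b = l b" if "b \<in> B" for b
  proof -
    have "T b = shift (l b) b + scale (l b) b" by (simp add: shift_def)
    then show ?thesis using B l[OF that] that
      by (simp add: representation_add representation_scale representation_basis span_base span_scale)
  qed
  with that[of B l] B l(1) span show thesis by blast
qed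

text \<open>
  Only basis vectors with eigenvalue \<open>c\<close> occur in the expansion of a generalized eigenvector for \<open>c\<close>.
  Hence an operator that scales each basis vector by a function of its eigenvalue scales each
  generalized eigenspace by that function, whatever the basis.
\<close>

lemma (in linear_endo) gen_eig_expand:
  assumes B: "finite B" "independent B" and l: "\<And>b. b \<in> B \<Longrightarrow> gen_eig (l b) b"
    and v: "gen_eig c v" "v \<in> span B"
  shows "v = (\<Sum>b\<in>{b\<in>B. l b = c}. scale (representation B v b) b)"
proof -
  define w where "w a = (\<Sum>b\<in>{b\<in>B. l b = a}. scale (representation B v b) b)" for a
  let ?A = "insert c (l ` B)"
  have gw: "gen_eig a (w a)" for a
  proof -
    have "w a \<in> {v. gen_eig a v}" unfolding w_def
      by (rule subspace_sum[OF subspace_gen_eig]) (auto intro: gen_eig_scale l)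
    then show ?thesis by simp
  qed
  have "(\<Sum>a\<in>?A. w a) = v"
    unfolding w_def using B
    by (subst sum.group) (auto simp: sum_representation_eq[OF B(2) v(2) B(1)])
  then have "(\<Sum>a\<in>?A. w a - (if a = c then v else 0)) = 0"
    using B(1) by (simp add: sum_subtractf del: sum.insert)
  moreover have "gen_eig a (w a - (if a = c then v else 0))" for a
    using gen_eig_add[OF gw gen_eig_scale[of a "if a = c then v else 0" "-1"]] v(1) by (auto simp: gw)
  ultimately have "w c - (if c = c then v else 0) = 0"
    using B(1) by (intro gen_eig_sum_zero[of ?A "\<lambda>a. w a - (if a = c then v else 0)" c]) auto
  then show ?thesis by (simp add: w_def)
qed

section \<open>Operators with vanishing trace form\<close>

definition fun_scale :: "('k \<Rightarrow> 'v \<Rightarrow> 'v) \<Rightarrow> 'k \<Rightarrow> ('v \<Rightarrow> 'v) \<Rightarrow> 'v \<Rightarrow> 'v"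
  where "fun_scale s c f = (\<lambda>v. s c (f v))"

definition commutator :: "('v \<Rightarrow> 'v::ab_group_add) \<Rightarrow> ('v \<Rightarrow> 'v) \<Rightarrow> 'v \<Rightarrow> 'v"
  where "commutator f g = (\<lambda>v. f (g v) - g (f v))"

lemma vector_space_fun_scale: "vector_space s \<Longrightarrow> vector_space (fun_scale s)"
  unfolding vector_space_def fun_scale_def by (auto simp: fun_eq_iff)

lemma (in linear_endo) linear_endo_commutator: "linear_endo (fun_scale scale) (commutator T)"
proof -
  interpret F: vector_space "fun_scale scale" by (rule vector_space_fun_scale) unfold_locales
  show ?thesis
    by unfold_locales
      (auto simp: fun_eq_iff fun_scale_def commutator_def T_add T_scale scale_right_diff_distrib)
qed

text \<open>
  This rests on \<open>(T - \<mu> - c) (a v) = ([T, a] - c a) v + a ((T - \<mu>) v)\<close>: each summand on the right has a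
  smaller order, in \<open>a\<close> or in \<open>v\<close>, and a double induction applies.
\<close>

lemma (in linear_endo) gen_eig_commutator_apply:
  assumes a: "linear_endo.gen_eig (fun_scale scale) (commutator T) c a"
    and lin: "Vector_Spaces.linear scale scale a"
    and v: "gen_eig \<mu> v"
  shows "gen_eig (\<mu> + c) (a v)"
proof -
  interpret A: linear_endo "fun_scale scale" "commutator T" by (rule linear_endo_commutator)
  have shift_eq: "A.shift c a v = T (a v) - a (T v) - scale c (a v)" for a v
    by (simp add: A.shift_def commutator_def fun_scale_def)
  show ?thesis
    using a lin v
  proof (induction arbitrary: v rule: A.gen_eig_induct)
    case zero
    then show ?case by simp
  next
    case (shift a)
    interpret a: Vector_Spaces.linear scale scale a by (rule shift.prems(1))
    have "Vector_Spaces.linear scale scale (A.shift c a)"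
      unfolding Vector_Spaces.linear_iff
      by (simp add: shift_eq a.add a.scale T_add T_scale vector_space_axioms
          scale_right_distrib scale_right_diff_distrib mult.commute)
    then have IH: "gen_eig (\<mu> + c) (A.shift c a v)" if "gen_eig \<mu> v" for v
      using shift.IH that by blast
    show ?case using shift.prems(2)
    proof (induction rule: gen_eig_induct)
      case zero
      then show ?case by (simp add: a.zero)
    next
      case inner: (shift v)
      have "linear_endo.shift scale T (\<mu> + c) (a v) = A.shift c a v + a (linear_endo.shift scale T \<mu> v)"
        by (simp add: shift_def shift_eq a.diff a.scale scale_left_distrib)
      then have "gen_eig (\<mu> + c) (linear_endo.shift scale T (\<mu> + c) (a v))"
        using gen_eig_add[OF IH[OF inner.hyps] inner.IH] by simp
      then show ?case by (simp add: gen_eig_shift_iff)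
    qed
  qed
qed

text \<open>
  The field is a vector space over \<open>\<rat>\<close>, and \<open>x\<close> extends to a basis.
\<close>

lemma rational_functional_exists:
  fixes x :: "'k::field_char_0"
  assumes "x \<noteq> 0"
  obtains \<phi> :: "'k \<Rightarrow> rat" where "\<And>y z. \<phi> (y + z) = \<phi> y + \<phi> z"
    and "\<And>q y. \<phi> (of_rat q * y) = q * \<phi> y" and "\<phi> x = 1"
proof -
  interpret vector_space_pair "\<lambda>q (y :: 'k). of_rat q * y" "(*) :: rat \<Rightarrow> rat \<Rightarrow> rat"
    by unfold_locales (simp_all add: algebra_simps of_rat_add of_rat_mult)
  have "vs1.independent {x}" using assms by (simp add: vs1.independent_insert vs1.independent_empty)
  then obtain g where "Vector_Spaces.linear (\<lambda>q (y :: 'k). of_rat q * y) (*) g" "g x = (1 :: rat)"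
    using linear_independent_extend[of "{x}" "\<lambda>_. 1"] by auto
  then show thesis using that[of g] by (simp add: Vector_Spaces.linear_iff)
qed

lemma (in vector_space) linear_image_in_span:
  assumes "Vector_Spaces.linear scale scale f" "\<And>b. b \<in> B \<Longrightarrow> f b \<in> span C" "v \<in> span B"
  shows "f v \<in> span C"
proof -
  interpret f: Vector_Spaces.linear scale scale f by fact
  have "subspace {v. f v \<in> span C}"
    by (auto simp: subspace_def f.zero f.add f.scale span_zero span_add span_scale)
  then have "span B \<subseteq> {v. f v \<in> span C}" using assms(2) by (intro span_minimal) auto
  then show ?thesis using assms(3) by blast
qed

text \<open>
  This is the linear algebra behind Cartan's criterion. Over the complex numbers one would take for
  \<open>d\<close> the operator with the complex conjugate eigenvalues and obtain \<open>\<Sum> \<bar>\<lambda>\<bar>\<^sup>2 = 0\<close>; over a general field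
  of characteristic zero, functionals with rational values supply the positivity.
\<close>

theorem trace_orthogonal_imp_nilpotent:
  fixes s :: "'k::{alg_closed_field, field_char_0} \<Rightarrow> 'v::ab_group_add \<Rightarrow> 'v"
  assumes vs: "vector_space s"
    and B0: "finite B0" "Modules.module.independent s B0"
    and W: "Modules.module.subspace (fun_scale s) W"
    and F: "finite F" "W \<subseteq> Modules.module.span (fun_scale s) F"
    and lin: "\<And>a. a \<in> W \<Longrightarrow> Vector_Spaces.linear s s a"
    and stable: "\<And>a b. a \<in> W \<Longrightarrow> b \<in> B0 \<Longrightarrow> a b \<in> Modules.module.span s B0"
    and closed: "\<And>a b. a \<in> W \<Longrightarrow> b \<in> W \<Longrightarrow> commutator a b \<in> W"
    and tr0: "\<And>a b. a \<in> W \<Longrightarrow> b \<in> W \<Longrightarrow> basis_trace s B0 (\<lambda>v. a (b v)) = 0"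
    and x: "x \<in> Modules.module.span (fun_scale s) {commutator a b | a b. a \<in> W \<and> b \<in> W}"
  shows "\<exists>N. \<forall>v \<in> Modules.module.span s B0. (x ^^ N) v = 0"
proof -
  interpret vector_space s by fact
  interpret E: vector_space "fun_scale s" by (rule vector_space_fun_scale[OF vs])
  have xW: "x \<in> W"
    using E.span_minimal[OF _ W, of "{commutator a b | a b. a \<in> W \<and> b \<in> W}"] closed x by blast
  interpret X: linear_endo s x
    using lin[OF xW] by unfold_locales (simp_all add: Vector_Spaces.linear_iff)
  interpret A: linear_endo "fun_scale s" "commutator x" by (rule X.linear_endo_commutator)
  define U where "U = span B0"
  have sU: "subspace U" by (simp add: U_def)
  have WU: "a u \<in> U" if "a \<in> W" "u \<in> U" for a u
    using linear_image_in_span[OF lin[OF that(1)] stable[OF that(1)]] that(2) unfolding U_def by blast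
  have "U \<subseteq> span {u\<in>U. \<exists>c. X.gen_eig c u}"
    using span_gen_eig[OF X.linear_endo_axioms B0(1) _ sU WU[OF xW]] unfolding U_def by blast
  from X.triangular_gen_eigenbasis[OF sU B0(1) _ WU[OF xW] this]
  obtain B l where B: "finite B" "independent B" "span B = U"
    and l: "\<And>b. b \<in> B \<Longrightarrow> X.gen_eig (l b) b" "\<And>b. b \<in> B \<Longrightarrow> representation B (x b) b = l b"
    unfolding U_def by blast
  have W_span: "W \<subseteq> E.span {a\<in>W. \<exists>c. A.gen_eig c a}"
    using span_gen_eig[OF A.linear_endo_axioms F W closed[OF xW]] by blast
  have \<phi>0: "\<phi> (l b) = 0" if b: "b \<in> B"
    and \<phi>: "\<And>y z. \<phi> (y + z) = \<phi> y + \<phi> z" "\<And>q y. \<phi> (of_rat q * y) = q * \<phi> y"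
    for b and \<phi> :: "'k \<Rightarrow> rat"
  proof -
    let ?\<psi> = "\<lambda>c. of_rat (\<phi> c) :: 'k"
    interpret p: vector_space_pair s s ..
    obtain d where d: "Vector_Spaces.linear s s d" "\<And>b. b \<in> B \<Longrightarrow> d b = s (?\<psi> (l b)) b"
      using p.linear_independent_extend[OF B(2), of "\<lambda>b. s (?\<psi> (l b)) b"] by blast
    interpret d: Vector_Spaces.linear s s d by (rule d(1))
    have dB: "d b \<in> span B" if "b \<in> B" for b
      using that by (simp add: d(2) span_scale span_base)
    then have dU: "d u \<in> U" if "u \<in> U" for u
      using linear_image_in_span[OF d(1)] that B(3) by blast
    \<comment> \<open>By construction \<open>d\<close> scales basis vectors; that it scales whole generalized eigenspaces is what
      makes the commutator with \<open>d\<close> computable.\<close>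
    have d_eig: "d v = s (?\<psi> c) v" if v: "X.gen_eig c v" "v \<in> U" for c v
    proof -
      let ?C = "{b\<in>B. l b = c}"
      have exp: "v = (\<Sum>b\<in>?C. s (representation B v b) b)"
        by (rule X.gen_eig_expand[OF B(1,2) l(1) v(1)]) (simp_all add: B(3) v(2))
      have "d (\<Sum>b\<in>?C. s (representation B v b) b)
          = s (?\<psi> c) (\<Sum>b\<in>?C. s (representation B v b) b)"
        unfolding d.sum scale_sum_right by (intro sum.cong) (auto simp: d.scale d(2) mult.commute)
      then show ?thesis by (simp flip: exp)
    qed
    \<comment> \<open>\<open>W\<close> is stable under the commutator with \<open>d\<close>, as operators on \<open>U\<close>. For a generalized eigenvector
      \<open>a\<close> of the commutator with \<open>x\<close>, with eigenvalue \<open>c\<close>, the operator \<open>[d, a]\<close> is \<open>\<phi> c \<cdot> a\<close>, because \<open>\<phi>\<close> is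
      additive and \<open>a\<close> maps the eigenvalue \<open>l b\<close> to \<open>l b + c\<close>.\<close>
    have comm: "\<exists>a'\<in>W. \<forall>v\<in>U. d (a v) - a (d v) = a' v" if "a \<in> W" for a
    proof -
      have "a \<in> E.span {a\<in>W. \<exists>c. A.gen_eig c a}" using W_span that by blast
      then show ?thesis
      proof (induction rule: E.span_induct_alt)
        case base
        show ?case using E.subspace_0[OF W] by (intro bexI[of _ 0]) (simp_all add: d.zero)
      next
        case (step e a a1)
        from step(1) obtain c where a: "a \<in> W" "A.gen_eig c a" by blast
        interpret a: Vector_Spaces.linear s s a by (rule lin[OF a(1)])
        have aU: "d (a v) - a (d v) = s (?\<psi> c) (a v)" if "v \<in> U" for v
        proof -
          have sub: "subspace {v. d (a v) - a (d v) = s (?\<psi> c) (a v)}"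
            by (simp add: subspace_def d.zero a.zero d.add a.add d.scale a.scale
                scale_right_distrib scale_right_diff_distrib[symmetric] mult.commute
                add_diff_add)
          have "b \<in> {v. d (a v) - a (d v) = s (?\<psi> c) (a v)}" if b: "b \<in> B" for b
          proof -
            have bU: "b \<in> U" using b B(3) span_base by blast
            have "X.gen_eig (l b + c) (a b)"
              by (rule X.gen_eig_commutator_apply[OF a(2) lin[OF a(1)] l(1)[OF b]])
            then have "d (a b) = s (?\<psi> (l b + c)) (a b)" by (rule d_eig[OF _ WU[OF a(1) bU]])
            then show ?thesis
              by (simp add: d(2)[OF b] a.scale \<phi> of_rat_add scale_left_distrib)
          qed
          then have "span B \<subseteq> {v. d (a v) - a (d v) = s (?\<psi> c) (a v)}"
            by (intro span_minimal sub) blast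
          then show ?thesis using that B(3) by blast
        qed
        from step(2) obtain a1' where a1': "a1' \<in> W" "\<And>v. v \<in> U \<Longrightarrow> d (a1 v) - a1 (d v) = a1' v"
          by blast
        let ?a' = "fun_scale s (e * ?\<psi> c) a + a1'"
        have "?a' \<in> W" using a(1) a1'(1) by (intro E.subspace_add[OF W] E.subspace_scale[OF W])
        moreover have "d ((fun_scale s e a + a1) v) - (fun_scale s e a + a1) (d v) = ?a' v"
          if "v \<in> U" for v
        proof -
          have "d ((fun_scale s e a + a1) v) - (fun_scale s e a + a1) (d v)
              = s e (d (a v) - a (d v)) + (d (a1 v) - a1 (d v))"
            by (simp add: fun_scale_def d.add d.scale scale_right_diff_distrib)
          then show ?thesis by (simp add: aU[OF that] a1'(2)[OF that] fun_scale_def)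
        qed
        ultimately show ?case by blast
      qed
    qed
    have B0U: "b \<in> U" if "b \<in> B0" for b using that by (simp add: U_def span_base)
    \<comment> \<open>\<open>tr (d [a, b]) = tr ([d, a] b)\<close>, and the trace form vanishes on \<open>W\<close>.\<close>
    have tr_d: "basis_trace s B0 (\<lambda>v. d (y v)) = 0"
      if "y \<in> E.span {commutator a b | a b. a \<in> W \<and> b \<in> W}" for y
    proof -
      let ?S = "{y\<in>W. basis_trace s B0 (\<lambda>v. d (y v)) = 0}"
      have sub: "E.subspace ?S"
      proof (rule E.subspaceI)
        show "0 \<in> ?S"
          using E.subspace_0[OF W]
          by (simp add: d.zero basis_trace_def representation_zero)
      next
        fix y z assume yz: "y \<in> ?S" "z \<in> ?S"
        have "d (y b) \<in> span B0" "d (z b) \<in> span B0" if "b \<in> B0" for b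
          using yz dU WU B0U[OF that] unfolding U_def by blast+
        then show "y + z \<in> ?S" using yz
          by (simp add: E.subspace_add[OF W] d.add basis_trace_add_diff(1)[OF B0])
      next
        fix c y assume y: "y \<in> ?S"
        have "d (y b) \<in> span B0" if "b \<in> B0" for b
          using y dU WU B0U[OF that] unfolding U_def by blast
        then show "fun_scale s c y \<in> ?S" using y E.subspace_scale[OF W, of y c]
          by (simp add: fun_scale_def d.scale basis_trace_scale[OF B0])
      qed
      have "commutator a b \<in> ?S" if ab: "a \<in> W" "b \<in> W" for a b
      proof -
        obtain a' where a': "a' \<in> W" "\<And>v. v \<in> U \<Longrightarrow> d (a v) - a (d v) = a' v"
          using comm[OF ab(1)] by blast
        have in_U: "d (a (b v)) \<in> span B0" "d (b (a v)) \<in> span B0" "a (d (b v)) \<in> span B0"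
          if "v \<in> B0" for v
          using ab dU WU B0U[OF that] unfolding U_def by blast+
        have "basis_trace s B0 (\<lambda>v. d (b (a v))) = basis_trace s B0 (\<lambda>v. a (d (b v)))"
        proof (rule basis_trace_commute[OF B0 B0, of "\<lambda>v. d (b v)" a])
          show "Vector_Spaces.linear s s (\<lambda>v. d (b v))"
            using Vector_Spaces.linear_compose[OF lin[OF ab(2)] d(1)] by (simp add: comp_def)
          show "Vector_Spaces.linear s s a" by (rule lin[OF ab(1)])
        qed (use ab dU WU B0U in \<open>auto simp: U_def\<close>)
        moreover have "basis_trace s B0 (\<lambda>v. d (a (b v))) - basis_trace s B0 (\<lambda>v. a (d (b v)))
            = basis_trace s B0 (\<lambda>v. a' (b v))"
          using a'(2)[OF WU[OF ab(2) B0U]]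
          by (subst basis_trace_add_diff(2)[OF B0 in_U(1,3), symmetric]) (simp_all add: basis_trace_def)
        moreover have "basis_trace s B0 (\<lambda>v. d (commutator a b v))
            = basis_trace s B0 (\<lambda>v. d (a (b v))) - basis_trace s B0 (\<lambda>v. d (b (a v)))"
          using in_U by (simp add: commutator_def d.diff basis_trace_add_diff(2)[OF B0])
        ultimately show ?thesis using tr0[OF a'(1) ab(2)] closed[OF ab] by simp
      qed
      then have "E.span {commutator a b | a b. a \<in> W \<and> b \<in> W} \<subseteq> ?S"
        by (intro E.span_minimal sub) blast
      then show ?thesis using that by blast
    qed
    have "Vector_Spaces.linear s s (\<lambda>v. d (x v))"
      using Vector_Spaces.linear_compose[OF lin[OF xW] d(1)] by (simp add: comp_def)
    then have "basis_trace s B0 (\<lambda>v. d (x v)) = basis_trace s B (\<lambda>v. d (x v))"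
      using B B0 dU WU[OF xW] by (intro basis_trace_change_basis) (auto simp: U_def)
    with tr_d[OF x] have "0 = (\<Sum>b\<in>B. representation B (d (x b)) b)" by (simp add: basis_trace_def)
    also have "\<dots> = (\<Sum>b\<in>B. ?\<psi> (l b) * l b)"
    proof (rule sum.cong[OF refl])
      fix b assume b: "b \<in> B"
      have "x b \<in> span B" using WU[OF xW] B(3) span_base[OF b] by blast
      then have "representation B (d (x b)) b
          = (\<Sum>c\<in>B. representation B (x b) c * representation B (d c) b)"
        by (intro representation_linear_expand B dB d(1))
      also have "\<dots> = (\<Sum>c\<in>B. if c = b then ?\<psi> (l b) * l b else 0)"
        by (intro sum.cong refl)
          (auto simp: d(2) representation_scale representation_basis B(2) span_base l(2) mult.commute)
      also have "\<dots> = ?\<psi> (l b) * l b" using b B(1) by simp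
      finally show "representation B (d (x b)) b = ?\<psi> (l b) * l b" .
    qed
    finally have sum0: "(\<Sum>b\<in>B. ?\<psi> (l b) * l b) = 0" by simp
    have "\<phi> 0 = 0" using \<phi>(2)[of 0 0] by simp
    then have \<phi>_sum: "\<phi> (\<Sum>b\<in>S. f b) = (\<Sum>b\<in>S. \<phi> (f b))" for f and S :: "'v set"
      by (induction S rule: infinite_finite_induct) (simp_all add: \<phi>)
    \<comment> \<open>Applying \<open>\<phi>\<close> once more turns the trace into a sum of squares of rational numbers.\<close>
    have "(\<Sum>b\<in>B. \<phi> (l b) * \<phi> (l b)) = \<phi> (\<Sum>b\<in>B. ?\<psi> (l b) * l b)"
      unfolding \<phi>_sum by (simp add: \<phi>)
    with sum0 \<open>\<phi> 0 = 0\<close> have "(\<Sum>b\<in>B. \<phi> (l b) * \<phi> (l b)) = 0" by simp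
    then show ?thesis using b by (simp add: sum_nonneg_eq_0_iff[OF B(1)])
  qed
  have l0: "l b = 0" if "b \<in> B" for b
  proof (rule ccontr)
    assume "l b \<noteq> 0"
    then obtain \<phi> :: "'k \<Rightarrow> rat" where \<phi>: "\<And>y z. \<phi> (y + z) = \<phi> y + \<phi> z"
      "\<And>q y. \<phi> (of_rat q * y) = q * \<phi> y" "\<phi> (l b) = 1" using rational_functional_exists by metis
    with \<phi>0[OF that \<phi>(1,2)] show False by simp
  qed
  have shift0: "X.shift 0 = x" by (simp add: X.shift_def fun_eq_iff)
  have "\<forall>b\<in>B. \<exists>k. (x ^^ k) b = 0"
    using l(1) l0 unfolding X.gen_eig_def by (metis shift0)
  then obtain k where k: "\<And>b. b \<in> B \<Longrightarrow> (x ^^ k b) b = 0" by metis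
  define N where "N = (\<Sum>b\<in>B. k b)"
  have "(x ^^ N) b = 0" if b: "b \<in> B" for b
    using X.shift_pow_mono[of "k b" 0 b N] k[OF b] member_le_sum[of b B k] b B(1)
    by (simp add: shift0 N_def)
  moreover have "subspace {v. (x ^^ N) v = 0}"
    using X.shift_pow_add[where k = N and c = 0] X.shift_pow_scale[where k = N and c = 0]
      X.shift_pow_0[where k = N and c = 0]
    by (simp add: subspace_def shift0)
  ultimately have "span B \<subseteq> {v. (x ^^ N) v = 0}" by (intro span_minimal) auto
  then show ?thesis using B(3) unfolding U_def by blast
qed

section \<open>Engel's theorem\<close>

context lie_algebra
begin

lemma bracket_linear: "Vector_Spaces.linear scale scale (bracket x)"
  "Vector_Spaces.linear scale scale (\<lambda>x. bracket x y)"
  using bilinear_mult by (auto simp: bilinear_map_def)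

lemma bracket_simps:
  "bracket (x + y) z = bracket x z + bracket y z" "bracket x (y + z) = bracket x y + bracket x z"
  "bracket (scale c x) z = scale c (bracket x z)" "bracket x (scale c z) = scale c (bracket x z)"
  using bracket_linear by (auto simp: Vector_Spaces.linear_iff)

lemma bracket_0 [simp]: "bracket x 0 = 0" "bracket 0 x = 0"
  using bracket_simps(3)[of 0 0 x] bracket_simps(4)[of x 0 0] by simp_all

lemma anticommutative: "bracket x y = - bracket y x"
proof -
  have "bracket x y + bracket y x = 0"
    using alternating[of "x + y"] unfolding bracket_simps by (simp add: alternating add.commute)
  then show ?thesis by (simp add: eq_neg_iff_add_eq_0)
qed

lemma bracket_neg: "bracket x (- y) = - bracket x y" "bracket (- x) y = - bracket x y"
  using bracket_simps(4)[of x "-1" y] bracket_simps(3)[of "-1" x y] by simp_all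

text \<open>
  The Jacobi identity, read as saying that \<open>ad x\<close> is a derivation.
\<close>

lemma bracket_derivation: "bracket x (bracket y z) = bracket (bracket x y) z + bracket y (bracket x z)"
proof -
  have "bracket x (bracket y z) = - (bracket y (bracket z x)) - bracket z (bracket x y)"
    using jacobi[of x y z] by (simp add: eq_neg_iff_add_eq_0 algebra_simps)
  also have "bracket y (bracket z x) = - bracket y (bracket x z)"
    by (simp add: anticommutative[of z x] bracket_neg)
  also have "bracket z (bracket x y) = - bracket (bracket x y) z" by (rule anticommutative)
  finally show ?thesis by simp
qed

definition lie_subalgebra :: "'a set \<Rightarrow> bool"
  where "lie_subalgebra J \<longleftrightarrow> subspace J \<and> (\<forall>x\<in>J. \<forall>y\<in>J. bracket x y \<in> J)"

text \<open>
  The iterates of this map, started at the whole algebra, form a descending chain of subspaces. It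
  reaches zero exactly when all sufficiently long products of operators \<open>ad a\<close> with \<open>a \<in> M\<close> vanish, so
  it measures nilpotency of the action of \<open>M\<close> and avoids words of operators. With both arguments
  equal it is the derived subalgebra.
\<close>

definition bracket_span :: "'a set \<Rightarrow> 'a set \<Rightarrow> 'a set"
  where "bracket_span M U = span {bracket a v | a v. a \<in> M \<and> v \<in> U}"

lemma bracket_span_leI:
  assumes "subspace U'" "\<And>a v. a \<in> M \<Longrightarrow> v \<in> U \<Longrightarrow> bracket a v \<in> U'"
  shows "bracket_span M U \<subseteq> U'"
  unfolding bracket_span_def using assms by (intro span_minimal) auto

lemma bracket_spanI: "a \<in> M \<Longrightarrow> v \<in> U \<Longrightarrow> bracket a v \<in> bracket_span M U"
  unfolding bracket_span_def by (intro span_base) auto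

lemma bracket_span_mono: "M \<subseteq> N \<Longrightarrow> U \<subseteq> U' \<Longrightarrow> bracket_span M U \<subseteq> bracket_span N U'"
  unfolding bracket_span_def by (intro span_mono) auto

lemma bracket_span_pow_subspace: "subspace ((bracket_span M ^^ k) UNIV)"
  by (cases k) (auto simp: bracket_span_def)

lemma bracket_span_pow_decreasing: "(bracket_span M ^^ Suc k) UNIV \<subseteq> (bracket_span M ^^ k) UNIV"
  by (induction k) (auto intro: bracket_span_mono[THEN subsetD])

lemma normalizer_preserves_bracket_span_pow:
  assumes "\<And>a. a \<in> M \<Longrightarrow> bracket y a \<in> M"
  shows "v \<in> (bracket_span M ^^ k) UNIV \<Longrightarrow> bracket y v \<in> (bracket_span M ^^ k) UNIV"
proof (induction k arbitrary: v)
  case (Suc k)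
  let ?V = "\<lambda>k. (bracket_span M ^^ k) UNIV"
  have sub: "subspace {v. bracket y v \<in> ?V (Suc k)}"
    using bracket_span_pow_subspace[of "Suc k" M]
    by (simp add: subspace_def bracket_simps)
  have "bracket_span M (?V k) \<subseteq> {v. bracket y v \<in> ?V (Suc k)}"
  proof (rule bracket_span_leI[OF sub], rule CollectI)
    fix a v assume av: "a \<in> M" "v \<in> ?V k"
    have "bracket (bracket y a) v \<in> ?V (Suc k)" "bracket a (bracket y v) \<in> ?V (Suc k)"
      using av Suc.IH assms by (auto intro: bracket_spanI)
    then show "bracket y (bracket a v) \<in> ?V (Suc k)"
      unfolding bracket_derivation[of y a v] by (rule subspace_add[OF bracket_span_pow_subspace])
  qed
  with Suc.prems show ?case by auto
qed simp

text \<open>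
  If \<open>V k\<close> is the chain of \<open>M\<close>, then modulo \<open>V (k + 1)\<close> an element \<open>a + c y\<close> acts on \<open>V k\<close> as \<open>c \<cdot> ad y\<close>.
  Hence \<open>p\<close> factors map \<open>V k\<close> into \<open>V (k + 1)\<close>, and \<open>p m\<close> factors give zero.
\<close>

lemma nilpotent_extend_by_normalizer:
  assumes M: "subspace M" and y: "\<And>a. a \<in> M \<Longrightarrow> bracket y a \<in> M"
    and nilM: "(bracket_span M ^^ m) UNIV = {0}" and nily: "\<And>v. (bracket y ^^ p) v = 0"
  shows "(bracket_span {a + scale c y | a c. a \<in> M} ^^ (p * m)) UNIV = {0}"
proof -
  let ?M' = "{a + scale c y | a c. a \<in> M}" and ?V = "\<lambda>k. (bracket_span M ^^ k) UNIV"
  have pow_lin: "(bracket y ^^ q) (u + v) = (bracket y ^^ q) u + (bracket y ^^ q) v"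
    "(bracket y ^^ q) (scale c v) = scale c ((bracket y ^^ q) v)" for q u v c
    by (induction q) (auto simp: bracket_simps)
  have pow_in: "(bracket y ^^ q) v \<in> ?V k" if "v \<in> ?V k" for q v k
    by (induction q) (auto intro: that normalizer_preserves_bracket_span_pow[OF y])
  have word: "(bracket_span ?M' ^^ q) (?V k) \<subseteq> {(bracket y ^^ q) v + w | v w. v \<in> ?V k \<and> w \<in> ?V (Suc k)}"
    (is "_ \<subseteq> ?S q") for q k
  proof (induction q)
    case 0
    show ?case using subspace_0[OF bracket_span_pow_subspace[of "Suc k" M]] by force
  next
    case (Suc q)
    have sub: "subspace (?S (Suc q))"
    proof (rule subspaceI)
      have "(bracket y ^^ Suc q) 0 + 0 = 0" using pow_lin(2)[of "Suc q" 0 0]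
        by (simp only: scale_zero_left add_0_right)
      then show "0 \<in> ?S (Suc q)"
        using subspace_0[OF bracket_span_pow_subspace, of k M] subspace_0[OF bracket_span_pow_subspace, of "Suc k" M]
        by (metis (mono_tags, lifting) mem_Collect_eq)
    next
      fix z z' assume "z \<in> ?S (Suc q)" "z' \<in> ?S (Suc q)"
      then obtain v w v' w' where *: "v \<in> ?V k" "w \<in> ?V (Suc k)" "v' \<in> ?V k" "w' \<in> ?V (Suc k)"
        "z = (bracket y ^^ Suc q) v + w" "z' = (bracket y ^^ Suc q) v' + w'" by blast
      then have "z + z' = (bracket y ^^ Suc q) (v + v') + (w + w')"
        by (simp only: pow_lin) (simp add: algebra_simps)
      moreover have "v + v' \<in> ?V k" "w + w' \<in> ?V (Suc k)"
        using * subspace_add[OF bracket_span_pow_subspace] by blast+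
      ultimately show "z + z' \<in> ?S (Suc q)" by blast
    next
      fix c z assume "z \<in> ?S (Suc q)"
      then obtain v w where *: "v \<in> ?V k" "w \<in> ?V (Suc k)" "z = (bracket y ^^ Suc q) v + w" by blast
      then have "scale c z = (bracket y ^^ Suc q) (scale c v) + scale c w"
        by (simp only: pow_lin scale_right_distrib)
      moreover have "scale c v \<in> ?V k" "scale c w \<in> ?V (Suc k)"
        using * subspace_scale[OF bracket_span_pow_subspace] by blast+
      ultimately show "scale c z \<in> ?S (Suc q)" by blast
    qed
    have "bracket_span ?M' ((bracket_span ?M' ^^ q) (?V k)) \<subseteq> ?S (Suc q)"
    proof (rule bracket_span_leI[OF sub])
      fix b z assume "b \<in> ?M'" "z \<in> (bracket_span ?M' ^^ q) (?V k)"
      with Suc obtain a c v w where *: "a \<in> M" "b = a + scale c y" "v \<in> ?V k" "w \<in> ?V (Suc k)"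
        "z = (bracket y ^^ q) v + w" by blast
      let ?w' = "bracket a ((bracket y ^^ q) v) + bracket a w + scale c (bracket y w)"
      have "bracket b z = (bracket y ^^ Suc q) (scale c v) + ?w'"
        by (simp add: * bracket_simps pow_lin algebra_simps)
      moreover have "scale c v \<in> ?V k" using *(3) by (rule subspace_scale[OF bracket_span_pow_subspace])
      moreover have "?w' \<in> ?V (Suc k)"
      proof (intro subspace_add[OF bracket_span_pow_subspace] subspace_scale[OF bracket_span_pow_subspace])
        show "bracket a ((bracket y ^^ q) v) \<in> ?V (Suc k)"
          using bracket_spanI[OF *(1) pow_in[OF *(3)]] by simp
        show "bracket a w \<in> ?V (Suc k)"
          using bracket_spanI[OF *(1) *(4)[THEN subsetD[OF bracket_span_pow_decreasing]]] by simp
        show "bracket y w \<in> ?V (Suc k)" by (rule normalizer_preserves_bracket_span_pow[OF y *(4)])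
      qed
      ultimately show "bracket b z \<in> ?S (Suc q)" by blast
    qed
    then show ?case by simp
  qed
  have mono: "(bracket_span ?M' ^^ q) U \<subseteq> (bracket_span ?M' ^^ q) U'" if "U \<subseteq> U'" for q U U'
    using that by (induction q) (auto intro: bracket_span_mono[THEN subsetD])
  have "(bracket_span ?M' ^^ (p * k)) UNIV \<subseteq> ?V k" for k
  proof (induction k)
    case (Suc k)
    have "(bracket_span ?M' ^^ (p * Suc k)) UNIV = (bracket_span ?M' ^^ p) ((bracket_span ?M' ^^ (p * k)) UNIV)"
      by (simp add: funpow_add)
    also have "\<dots> \<subseteq> (bracket_span ?M' ^^ p) (?V k)" by (rule mono[OF Suc])
    also have "\<dots> \<subseteq> ?V (Suc k)" using word[of p k] by (auto simp: nily)
    finally show ?case .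
  qed simp
  from this[of m] nilM show ?thesis using subspace_0[OF bracket_span_pow_subspace] by fastforce
qed

text \<open>
  Otherwise every element of \<open>J\<close> outside \<open>M\<close> could be moved by some \<open>a \<in> M\<close> to another such element,
  one step further down the chain of \<open>M\<close>; the chain ends in zero, which belongs to \<open>M\<close>.
\<close>

lemma nilpotent_normalizer_exists:
  assumes M: "lie_subalgebra M" and nilM: "(bracket_span M ^^ m) UNIV = {0}"
    and J: "lie_subalgebra J" and MJ: "M \<subset> J"
  shows "\<exists>y\<in>J. y \<notin> M \<and> (\<forall>a\<in>M. bracket y a \<in> M)"
proof (rule ccontr)
  assume no: "\<not> ?thesis"
  have "\<exists>y\<in>J. y \<notin> M \<and> y \<in> (bracket_span M ^^ k) UNIV" for k
  proof (induction k)
    case 0 then show ?case using MJ by auto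
  next
    case (Suc k)
    then obtain y where y: "y \<in> J" "y \<notin> M" "y \<in> (bracket_span M ^^ k) UNIV" by blast
    with no obtain a where a: "a \<in> M" "bracket y a \<notin> M" by blast
    have "bracket a y \<notin> M"
    proof
      assume "bracket a y \<in> M"
      then have "- bracket a y \<in> M" using M by (auto simp: lie_subalgebra_def subspace_neg)
      with a(2) show False by (simp flip: anticommutative)
    qed
    moreover have "bracket a y \<in> J" using J MJ a y unfolding lie_subalgebra_def by blast
    moreover have "bracket a y \<in> (bracket_span M ^^ Suc k) UNIV" using bracket_spanI[OF a(1) y(3)] by simp
    ultimately show ?case by blast
  qed
  from this[of m] nilM M show False by (auto simp: lie_subalgebra_def subspace_0)
qed

text \<open>
  A subalgebra of \<open>J\<close> of maximal dimension among those that act nilpotently must be \<open>J\<close> itself, for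
  otherwise an element that normalizes it could be adjoined. The action on the whole algebra contains
  the adjoint action on \<open>J\<close>, and this is what provides the normalizing element.
\<close>

theorem engel:
  assumes J: "lie_subalgebra J" and nil: "\<And>x. x \<in> J \<Longrightarrow> \<exists>p. \<forall>v. (bracket x ^^ p) v = 0"
  shows "\<exists>m. (bracket_span J ^^ m) UNIV = {0}"
proof -
  obtain B where "finite_dimensional_vector_space scale B" using finite_dimensional by blast
  then interpret finite_dimensional_vector_space scale B .
  let ?P = "\<lambda>M. lie_subalgebra M \<and> M \<subseteq> J \<and> (\<exists>m. (bracket_span M ^^ m) UNIV = {0})"
  have "bracket_span {0} UNIV \<subseteq> {0}" by (rule bracket_span_leI) auto
  then have "(bracket_span {0} ^^ 1) UNIV = {0}"
    using subspace_0[OF bracket_span_pow_subspace[of 1 "{0}"]] by (intro equalityI) auto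
  then have "?P {0}" using J by (fastforce simp: lie_subalgebra_def subspace_0)
  moreover have "\<forall>M. ?P M \<longrightarrow> dim M < Suc dimension" using dim_subset_UNIV by (simp add: less_Suc_eq_le)
  ultimately obtain M where M: "?P M" and max: "\<And>N. ?P N \<Longrightarrow> dim N \<le> dim M"
    using ex_has_greatest_nat[of ?P "{0}" dim "Suc dimension"] by blast
  then obtain m where m: "(bracket_span M ^^ m) UNIV = {0}" by blast
  have "M = J"
  proof (rule ccontr)
    assume "M \<noteq> J"
    with M obtain y where y: "y \<in> J" "y \<notin> M" "\<And>a. a \<in> M \<Longrightarrow> bracket y a \<in> M"
      using nilpotent_normalizer_exists[OF _ m J] by blast
    obtain p where p: "\<And>v. (bracket y ^^ p) v = 0" using nil[OF y(1)] by blast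
    let ?M' = "{a + scale c y | a c. a \<in> M}"
    have subM: "subspace M" using M by (simp add: lie_subalgebra_def)
    have "(bracket_span ?M' ^^ (p * m)) UNIV = {0}" by (rule nilpotent_extend_by_normalizer[OF subM y(3) m p])
    moreover have "?M' \<subseteq> J"
      using M y J unfolding lie_subalgebra_def by (auto intro!: subspace_add subspace_scale)
    moreover have "lie_subalgebra ?M'"
      unfolding lie_subalgebra_def
    proof (intro conjI ballI subspaceI)
      show "0 \<in> ?M'" using subspace_0[OF subM] by (auto intro!: exI[of _ 0])
    next
      fix u v assume "u \<in> ?M'" "v \<in> ?M'"
      then obtain a c b d where *: "a \<in> M" "b \<in> M" "u = a + scale c y" "v = b + scale d y" by blast
      then have "u + v = (a + b) + scale (c + d) y" by (simp add: algebra_simps)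
      then show "u + v \<in> ?M'" using subspace_add[OF subM *(1,2)] by blast
      have "bracket u v = (bracket a b + scale c (bracket y b) - scale d (bracket y a)) + scale 0 y"
        by (simp add: * bracket_simps alternating anticommutative[of a y] algebra_simps)
      moreover have "bracket a b + scale c (bracket y b) - scale d (bracket y a) \<in> M"
        using M * y(3) subM
        by (auto simp: lie_subalgebra_def intro!: subspace_add subspace_diff subspace_scale)
      ultimately show "bracket u v \<in> ?M'" by blast
    next
      fix e u assume "u \<in> ?M'"
      then obtain a c where *: "a \<in> M" "u = a + scale c y" by blast
      then have "scale e u = scale e a + scale (e * c) y" by (simp add: algebra_simps)
      then show "scale e u \<in> ?M'" using subspace_scale[OF subM *(1)] by blast
    qed
    ultimately have le: "dim ?M' \<le> dim M" using max by blast
    have "M \<subseteq> ?M'"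
    proof
      fix a assume "a \<in> M"
      then show "a \<in> ?M'" by (intro CollectI exI[of _ a] exI[of _ 0]) simp
    qed
    with le have "M = ?M'"
      using \<open>lie_subalgebra ?M'\<close> subM subspace_dim_equal[of M ?M'] by (simp add: lie_subalgebra_def)
    moreover have "0 + scale 1 y \<in> ?M'" using subspace_0[OF subM] by blast
    ultimately show False using y(2) by simp
  qed
  with m show ?thesis by blast
qed

text \<open>
  A perfect \<open>J\<close> is contained in every term of its own chain.
\<close>

lemma perfect_nilpotent_trivial:
  assumes J: "lie_subalgebra J" and nil: "\<And>x. x \<in> J \<Longrightarrow> \<exists>p. \<forall>v. (bracket x ^^ p) v = 0"
    and perfect: "J \<subseteq> bracket_span J J"
  shows "J = {0}"
proof -
  obtain m where m: "(bracket_span J ^^ m) UNIV = {0}" using engel[OF J nil] by blast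
  have "J \<subseteq> (bracket_span J ^^ k) UNIV" for k
  proof (induction k)
    case (Suc k)
    then show ?case using perfect bracket_span_mono[of J J J "(bracket_span J ^^ k) UNIV"] by simp
  qed simp
  with m J show ?thesis by (auto simp: lie_subalgebra_def subspace_0)
qed

end

section \<open>Extension of scalars to the algebraic closure\<close>

definition ext_scale :: "'k::field \<Rightarrow> ('i \<Rightarrow> 'k) \<Rightarrow> 'i \<Rightarrow> 'k"
  where "ext_scale c f = (\<lambda>i. c * f i)"

lemma vector_space_ext_scale: "vector_space ext_scale"
  by unfold_locales (auto simp: ext_scale_def fun_eq_iff algebra_simps)

lemma sum_fun_apply: "(\<Sum>x\<in>A. f x) i = (\<Sum>x\<in>A. f x i)"
  by (induction A rule: infinite_finite_induct) simp_all

text \<open>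
  In coordinates, the extension of a finite-dimensional space to the algebraic closure consists of the
  functions supported on a basis. Its dimension varies with the space, so it is the span of the
  \<open>ext_vector\<close>s of the basis inside the type of all functions. The operator \<open>ext_operator f\<close> has the
  matrix of \<open>f\<close> and ignores coordinates outside the basis.
\<close>

locale coordinate_extension = finite_dimensional_vector_space scale Basis
  for scale :: "'l::field \<Rightarrow> 'g::ab_group_add \<Rightarrow> 'g" and Basis
begin

definition ext_vector :: "'g \<Rightarrow> 'g \<Rightarrow> 'l alg_closure"
  where "ext_vector v = (\<lambda>i. if i \<in> Basis then to_ac (representation Basis v i) else 0)"

definition ext_operator :: "('g \<Rightarrow> 'g) \<Rightarrow> ('g \<Rightarrow> 'l alg_closure) \<Rightarrow> 'g \<Rightarrow> 'l alg_closure"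
  where "ext_operator f w = (\<Sum>j\<in>Basis. ext_scale (w j) (ext_vector (f j)))"

sublocale V: vector_space "ext_scale :: 'l alg_closure \<Rightarrow> ('g \<Rightarrow> 'l alg_closure) \<Rightarrow> _"
  by (rule vector_space_ext_scale)

lemma ext_vector_add: "ext_vector (u + v) = ext_vector u + ext_vector v"
  and ext_vector_scale: "ext_vector (scale c v) = ext_scale (to_ac c) (ext_vector v)"
  by (auto simp: ext_vector_def ext_scale_def fun_eq_iff representation_add representation_scale
      independent_Basis span_Basis)

lemma ext_vector_0 [simp]: "ext_vector 0 = 0"
  by (simp add: ext_vector_def fun_eq_iff representation_zero)

lemma ext_vector_sum: "ext_vector (\<Sum>x\<in>A. f x) = (\<Sum>x\<in>A. ext_vector (f x))"
  by (induction A rule: infinite_finite_induct) (simp_all add: ext_vector_add)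

lemma ext_vector_diff: "ext_vector (u - v) = ext_vector u - ext_vector v"
  using ext_vector_add[of "u - v" v] by (simp add: algebra_simps)

lemma ext_vector_eq_0_iff: "ext_vector v = 0 \<longleftrightarrow> v = 0"
proof
  assume Ev: "ext_vector v = 0"
  have "representation Basis v i = 0" if "i \<in> Basis" for i
    using that fun_cong[OF Ev, of i] by (simp add: ext_vector_def)
  then have "(\<Sum>i\<in>Basis. scale (representation Basis v i) i) = 0" by simp
  then show "v = 0"
    using sum_representation_eq[OF independent_Basis, of v Basis] by (simp add: span_Basis finite_Basis)
qed simp

lemma ext_vector_on_basis: "i \<in> Basis \<Longrightarrow> ext_vector i j = (if j = i then 1 else 0)"
  by (simp add: ext_vector_def representation_basis independent_Basis)

lemma ext_vector_expand: "ext_vector v = (\<Sum>j\<in>Basis. ext_scale (to_ac (representation Basis v j)) (ext_vector j))"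
proof -
  have "v = (\<Sum>j\<in>Basis. scale (representation Basis v j) j)"
    using sum_representation_eq[OF independent_Basis, of v Basis] by (simp add: span_Basis finite_Basis)
  then have "ext_vector v = ext_vector (\<Sum>j\<in>Basis. scale (representation Basis v j) j)" by (rule arg_cong)
  then show ?thesis by (simp add: ext_vector_sum ext_vector_scale)
qed

lemma inj_on_ext_vector: "inj_on ext_vector Basis"
  by (rule inj_onI) (metis ext_vector_diff ext_vector_eq_0_iff eq_iff_diff_eq_0)

lemma ext_vector_basis: "finite (ext_vector ` Basis)" "V.independent (ext_vector ` Basis)" "ext_vector v \<in> V.span (ext_vector ` Basis)"
proof -
  show fin: "finite (ext_vector ` Basis)" using finite_Basis by simp
  show "V.independent (ext_vector ` Basis)"
  proof (rule V.independent_if_scalars_zero[OF fin])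
    fix c x assume 0: "(\<Sum>x\<in>ext_vector ` Basis. ext_scale (c x) x) = 0" and "x \<in> ext_vector ` Basis"
    then obtain i where i: "i \<in> Basis" "x = ext_vector i" by blast
    have "0 = (\<Sum>j\<in>Basis. ext_scale (c (ext_vector j)) (ext_vector j)) i"
      using 0 by (simp add: sum.reindex[OF inj_on_ext_vector])
    also have "\<dots> = (\<Sum>j\<in>Basis. c (ext_vector j) * ext_vector j i)"
      by (simp add: ext_scale_def sum_fun_apply)
    also have "\<dots> = (\<Sum>j\<in>Basis. if j = i then c (ext_vector i) else 0)"
      by (intro sum.cong) (auto simp: ext_vector_on_basis)
    also have "\<dots> = c x" using i finite_Basis by simp
    finally show "c x = 0" by simp
  qed
  show "ext_vector v \<in> V.span (ext_vector ` Basis)"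
    by (subst ext_vector_expand) (intro V.span_sum V.span_scale V.span_base imageI)
qed

lemma representation_ext_vector: "i \<in> Basis \<Longrightarrow> V.representation (ext_vector ` Basis) (ext_vector v) (ext_vector i) = to_ac (representation Basis v i)"
proof -
  assume i: "i \<in> Basis"
  have "V.representation (ext_vector ` Basis) (ext_vector v) (ext_vector i)
      = (\<Sum>j\<in>Basis. to_ac (representation Basis v j) * V.representation (ext_vector ` Basis) (ext_vector j) (ext_vector i))"
    by (subst ext_vector_expand) (simp add: V.representation_sum V.representation_scale ext_vector_basis V.span_scale)
  also have "\<dots> = (\<Sum>j\<in>Basis. if j = i then to_ac (representation Basis v i) else 0)"
  proof (rule sum.cong[OF refl])
    fix j assume j: "j \<in> Basis"
    have "V.representation (ext_vector ` Basis) (ext_vector j) (ext_vector i) = (if ext_vector i = ext_vector j then 1 else 0)"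
      using V.representation_basis[OF ext_vector_basis(2) imageI[OF j]] by simp
    also have "(ext_vector i = ext_vector j) = (j = i)" using inj_on_eq_iff[OF inj_on_ext_vector i j] by blast
    finally show "to_ac (representation Basis v j) * V.representation (ext_vector ` Basis) (ext_vector j) (ext_vector i)
      = (if j = i then to_ac (representation Basis v i) else 0)" by simp
  qed
  also have "\<dots> = to_ac (representation Basis v i)" using i finite_Basis by simp
  finally show ?thesis .
qed

lemma ext_operator_linear: "Vector_Spaces.linear ext_scale ext_scale (ext_operator f)"
  by (simp add: Vector_Spaces.linear_iff V.vector_space_axioms ext_operator_def V.scale_left_distrib
      sum.distrib V.scale_sum_right) (simp add: ext_scale_def mult.assoc)

lemma ext_operator_in_span: "ext_operator f w \<in> V.span (ext_vector ` Basis)"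
  unfolding ext_operator_def by (intro V.span_sum V.span_scale ext_vector_basis)

lemma ext_operator_ext_vector:
  assumes "Vector_Spaces.linear scale scale f"
  shows "ext_operator f (ext_vector v) = ext_vector (f v)"
proof -
  interpret f: Vector_Spaces.linear scale scale f by fact
  have "v = (\<Sum>j\<in>Basis. scale (representation Basis v j) j)"
    using sum_representation_eq[OF independent_Basis, of v Basis] by (simp add: span_Basis finite_Basis)
  then have "ext_vector (f v) = ext_vector (f (\<Sum>j\<in>Basis. scale (representation Basis v j) j))"
    by (rule arg_cong)
  also have "\<dots> = (\<Sum>j\<in>Basis. ext_scale (to_ac (representation Basis v j)) (ext_vector (f j)))"
    by (simp add: f.sum f.scale ext_vector_sum ext_vector_scale)
  finally show ?thesis by (simp add: ext_operator_def ext_vector_def[of v])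
qed

lemma ext_operator_compose:
  assumes "Vector_Spaces.linear scale scale f"
  shows "ext_operator f (ext_operator g w) = ext_operator (\<lambda>v. f (g v)) w"
proof -
  interpret ext_f: Vector_Spaces.linear ext_scale ext_scale "ext_operator f" by (rule ext_operator_linear)
  show ?thesis by (simp add: ext_operator_def[of g] ext_f.sum ext_f.scale ext_operator_ext_vector[OF assms]) (simp add: ext_operator_def)
qed

lemma ext_operator_add: "ext_operator (\<lambda>v. f v + g v) = ext_operator f + ext_operator g"
  and ext_operator_diff: "ext_operator (\<lambda>v. f v - g v) = ext_operator f - ext_operator g"
  and ext_operator_scale: "ext_operator (\<lambda>v. scale c (f v)) = fun_scale ext_scale (to_ac c) (ext_operator f)"
  by (auto simp: ext_operator_def fun_eq_iff ext_vector_add ext_vector_diff ext_vector_scale sum.distrib sum_subtractf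
      ext_scale_def algebra_simps sum_fun_apply fun_scale_def sum_distrib_left)

lemma trace_ext_operator:
  "basis_trace ext_scale (ext_vector ` Basis) (ext_operator f) = to_ac (basis_trace scale Basis f)"
proof -
  have "basis_trace ext_scale (ext_vector ` Basis) (ext_operator f)
      = (\<Sum>j\<in>Basis. V.representation (ext_vector ` Basis) (ext_operator f (ext_vector j)) (ext_vector j))"
    by (simp add: basis_trace_def sum.reindex[OF inj_on_ext_vector])
  also have "\<dots> = (\<Sum>j\<in>Basis. to_ac (representation Basis (f j) j))"
  proof (rule sum.cong[OF refl])
    fix j assume j: "j \<in> Basis"
    have "ext_operator f (ext_vector j) = (\<Sum>i\<in>Basis. if i = j then ext_vector (f j) else 0)"
      unfolding ext_operator_def using j by (intro sum.cong) (auto simp: ext_vector_on_basis)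
    then have "ext_operator f (ext_vector j) = ext_vector (f j)" using j finite_Basis by simp
    then show "V.representation (ext_vector ` Basis) (ext_operator f (ext_vector j)) (ext_vector j) = to_ac (representation Basis (f j) j)"
      using representation_ext_vector[OF j] by simp
  qed
  finally show ?thesis by (simp add: basis_trace_def to_ac_sum)
qed

end

section \<open>Cartan's criterion\<close>

text \<open>
  The closure \<open>W\<close> of \<open>ad J\<close> under linear combinations over the algebraic closure inherits everything
  that \<open>trace_orthogonal_imp_nilpotent\<close> asks for: the conditions are linear in each argument and so
  follow from the case of operators \<open>ad z\<close> with \<open>z \<in> J\<close>. Nilpotency descends, because extension of
  scalars is injective on vectors.
\<close>

lemma perfect_trace_zero_imp_nilpotent:
  fixes s :: "'l::field_char_0 \<Rightarrow> 'g::ab_group_add \<Rightarrow> 'g"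
  assumes lie: "lie_algebra s br"
    and J: "lie_algebra.lie_subalgebra s br J" and perfect: "J \<subseteq> lie_algebra.bracket_span s br J J"
    and tr0: "\<And>x y. x \<in> J \<Longrightarrow> y \<in> J \<Longrightarrow> killing_form s br x y = 0"
    and x: "x \<in> J"
  shows "\<exists>p. \<forall>v. (br x ^^ p) v = 0"
proof -
  interpret L: lie_algebra s br by fact
  obtain B where fd: "finite_dimensional_vector_space s B" using L.finite_dimensional by blast
  interpret C: coordinate_extension s B by (rule coordinate_extension.intro[OF fd])
  interpret F: vector_space "fun_scale (ext_scale :: 'l alg_closure \<Rightarrow> ('g \<Rightarrow> 'l alg_closure) \<Rightarrow> _)"
    by (rule vector_space_fun_scale[OF vector_space_ext_scale])
  define ad where "ad z = C.ext_operator (br z)" for z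
  define W where "W = F.span (ad ` J)"
  let ?B0 = "C.ext_vector ` B"
  have br_fun: "br (u + v) = (\<lambda>w. br u w + br v w)" "br (s c u) = (\<lambda>w. s c (br u w))"
    "br (br u v) = (\<lambda>w. br u (br v w) - br v (br u w))" for u v c
    by (simp_all add: L.bracket_simps fun_eq_iff L.bracket_derivation[of u v])
  have ad_add: "ad (u + v) = ad u + ad v"
    and ad_scale: "ad (s c u) = fun_scale ext_scale (to_ac c) (ad u)"
    and ad_bracket: "ad (br u v) = commutator (ad u) (ad v)" for u v c
    unfolding ad_def br_fun
    by (simp_all add: C.ext_operator_add C.ext_operator_scale C.ext_operator_diff commutator_def fun_eq_iff
        C.ext_operator_compose[OF L.bracket_linear(1)])
  have ad_0: "ad 0 = 0" using ad_scale[of 0 0] F.scale_zero_left[of "ad 0"] by simp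
  have sub_pre: "L.subspace {z. ad z \<in> S}" if "F.subspace S" for S
    using that by (simp add: L.subspace_def ad_0 ad_add ad_scale F.subspace_0 F.subspace_add
        F.subspace_scale)
  have subW: "F.subspace W" unfolding W_def by simp
  have adW: "ad z \<in> W" if "z \<in> J" for z using that by (simp add: W_def F.span_base)
  have W_le: "W \<subseteq> S" if "F.subspace S" "\<And>z. z \<in> J \<Longrightarrow> ad z \<in> S" for S
    unfolding W_def using that by (intro F.span_minimal) auto
  have lin: "Vector_Spaces.linear ext_scale ext_scale a" if "a \<in> W" for a
  proof -
    have "F.subspace {a. Vector_Spaces.linear ext_scale ext_scale a}"
      by (auto simp: F.subspace_def Vector_Spaces.linear_iff C.V.vector_space_axioms fun_scale_def
          C.V.scale_right_distrib mult.commute)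
    from W_le[OF this] that show ?thesis by (auto simp: ad_def C.ext_operator_linear)
  qed
  have stable: "a v \<in> C.V.span ?B0" if "a \<in> W" for a v
  proof -
    have "F.subspace {a. a v \<in> C.V.span ?B0}"
      by (auto simp: F.subspace_def fun_scale_def C.V.span_zero C.V.span_add C.V.span_scale)
    from W_le[OF this] that show ?thesis by (auto simp: ad_def C.ext_operator_in_span)
  qed
  have lin_simps: "b (u + v) = b u + b v" "b (ext_scale c u) = ext_scale c (b u)" "b 0 = 0"
    if "b \<in> W" for b u v c
    using lin[OF that] Vector_Spaces.linear_iff[of ext_scale ext_scale b]
      module_hom.zero[OF Vector_Spaces.linear.axioms(3)[OF lin[OF that]]] by auto
  have closed1: "commutator (ad z) b \<in> W" if z: "z \<in> J" and b: "b \<in> W" for z b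
  proof -
    note zs = lin_simps[OF adW[OF z]]
    have comm: "commutator (ad z) 0 = 0"
      "commutator (ad z) (b + b') = commutator (ad z) b + commutator (ad z) b'"
      "commutator (ad z) (fun_scale ext_scale c b) = fun_scale ext_scale c (commutator (ad z) b)"
      for b b' c
      by (auto simp: commutator_def fun_eq_iff zs fun_scale_def C.V.scale_right_diff_distrib)
    have "F.subspace {b. commutator (ad z) b \<in> W}"
      by (auto simp: F.subspace_def comm intro: F.subspace_0 F.subspace_add F.subspace_scale subW)
    from W_le[OF this] b J z show ?thesis
      by (auto simp: L.lie_subalgebra_def adW simp flip: ad_bracket)
  qed
  have closed: "commutator a b \<in> W" if a: "a \<in> W" and b: "b \<in> W" for a b
  proof -
    note bs = lin_simps[OF b]
    have comm: "commutator 0 b = 0"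
      "commutator (a + a') b = commutator a b + commutator a' b"
      "commutator (fun_scale ext_scale c a) b = fun_scale ext_scale c (commutator a b)" for a a' c
      by (auto simp: commutator_def fun_eq_iff bs fun_scale_def C.V.scale_right_diff_distrib)
    have "F.subspace {a. commutator a b \<in> W}"
      by (auto simp: F.subspace_def comm intro: F.subspace_0 F.subspace_add F.subspace_scale subW)
    from W_le[OF this] a closed1[OF _ b] show ?thesis by auto
  qed
  have tr0_ad: "basis_trace ext_scale ?B0 (\<lambda>v. ad z (ad z' v)) = 0" if "z \<in> J" "z' \<in> J" for z z'
  proof -
    have "basis_trace s B (\<lambda>v. br z (br z' v)) = killing_form s br z z'"
      unfolding killing_form_def comp_def
      by (rule lin_trace_eq_basis_trace[OF fd L.mult_mult_linear, symmetric])
    then show ?thesis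
      by (simp add: ad_def C.ext_operator_compose[OF L.bracket_linear(1)] C.trace_ext_operator tr0[OF that])
  qed
  note tr_add = C.V.basis_trace_add_diff(1)[OF C.ext_vector_basis(1,2)]
    and tr_scale = C.V.basis_trace_scale[OF C.ext_vector_basis(1,2)]
  have tr_zero: "basis_trace ext_scale ?B0 (\<lambda>v. 0) = 0"
    by (simp add: basis_trace_def C.V.representation_zero)
  have tr1: "basis_trace ext_scale ?B0 (\<lambda>v. ad z (b v)) = 0" if z: "z \<in> J" and b: "b \<in> W" for z b
  proof -
    note zs = lin_simps[OF adW[OF z]]
    have "F.subspace {b. basis_trace ext_scale ?B0 (\<lambda>v. ad z (b v)) = 0}"
      by (auto simp: F.subspace_def zs fun_scale_def tr_zero tr_add tr_scale stable adW z)
    from W_le[OF this] b tr0_ad[OF z] show ?thesis by auto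
  qed
  have tr: "basis_trace ext_scale ?B0 (\<lambda>v. a (b v)) = 0" if a: "a \<in> W" and b: "b \<in> W" for a b
  proof -
    have "F.subspace {a\<in>W. basis_trace ext_scale ?B0 (\<lambda>v. a (b v)) = 0}"
      using subW F.subspace_scale[OF subW]
      by (auto simp: F.subspace_def fun_scale_def tr_zero tr_add tr_scale stable)
    from W_le[OF this] a tr1[OF _ b] adW show ?thesis by auto
  qed
  have fin: "W \<subseteq> F.span (ad ` B)"
  proof (rule W_le)
    show "F.subspace (F.span (ad ` B))" by simp
    have "L.span B \<subseteq> {z. ad z \<in> F.span (ad ` B)}"
      by (intro L.span_minimal sub_pre) (auto intro: F.span_base)
    then show "ad z \<in> F.span (ad ` B)" for z using C.span_Basis by auto
  qed
  have "ad x \<in> F.span {commutator a b | a b. a \<in> W \<and> b \<in> W}"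
  proof -
    let ?S = "F.span {commutator a b | a b. a \<in> W \<and> b \<in> W}"
    have "L.bracket_span J J \<subseteq> {z. ad z \<in> ?S}"
    proof (rule L.bracket_span_leI[OF sub_pre], simp, rule CollectI)
      fix u v assume "u \<in> J" "v \<in> J"
      then show "ad (br u v) \<in> ?S" unfolding ad_bracket by (intro F.span_base) (auto intro: adW)
    qed
    then show ?thesis using perfect x by blast
  qed
  then have "\<exists>N. \<forall>v \<in> C.V.span ?B0. (ad x ^^ N) v = 0"
    by (intro trace_orthogonal_imp_nilpotent[OF vector_space_ext_scale C.ext_vector_basis(1,2) subW
        finite_imageI[OF C.finite_Basis] fin] lin stable closed tr)
  then obtain N where N: "\<And>v. v \<in> C.V.span ?B0 \<Longrightarrow> (ad x ^^ N) v = 0" by blast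
  have "(ad x ^^ n) (C.ext_vector v) = C.ext_vector ((br x ^^ n) v)" for n v
    by (induction n) (simp_all add: ad_def C.ext_operator_ext_vector[OF L.bracket_linear(1)])
  then have "(br x ^^ N) v = 0" for v
    using N[OF C.ext_vector_basis(3), of v] by (simp add: C.ext_vector_eq_0_iff)
  then show ?thesis by blast
qed

context lie_algebra
begin

lemma killing_form_simps:
  "killing_form scale bracket (x + y) z = killing_form scale bracket x z + killing_form scale bracket y z"
  "killing_form scale bracket (scale c x) z = c * killing_form scale bracket x z"
  "killing_form scale bracket x (y + z) = killing_form scale bracket x y + killing_form scale bracket x z"
  "killing_form scale bracket x (scale c z) = c * killing_form scale bracket x z"
  using killing_form_bilinear by (simp_all add: bilinear_map_iff)

lemma killing_form_0 [simp]: "killing_form scale bracket 0 x = 0"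
  using killing_form_simps(2)[of 0 0 x] by simp

lemma killing_form_neg: "killing_form scale bracket (- x) y = - killing_form scale bracket x y"
  using killing_form_simps(2)[of "-1" x y] by simp

lemma killing_form_invariant: "invariant_form bracket (killing_form scale bracket)"
  unfolding invariant_form_def
proof (intro allI)
  fix x y z
  obtain B where B: "finite_dimensional_vector_space scale B" using finite_dimensional by blast
  have lin3: "Vector_Spaces.linear scale scale (\<lambda>v. bracket x (bracket y (bracket z v)))" for x y z
    using Vector_Spaces.linear_compose[OF mult_mult_linear mult_linear] by (simp add: comp_def)
  have "killing_form scale bracket (bracket x y) z
      = lin_trace scale (\<lambda>v. bracket x (bracket y (bracket z v)) - bracket y (bracket x (bracket z v)))"
    unfolding killing_form_def comp_def by (simp add: bracket_derivation[of x y])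
  also have "\<dots> = lin_trace scale (\<lambda>v. bracket x (bracket y (bracket z v)))
      - lin_trace scale (\<lambda>v. bracket y (bracket x (bracket z v)))"
    by (rule lin_trace_add_diff(2)[OF B lin3 lin3])
  also have "lin_trace scale (\<lambda>v. bracket y (bracket x (bracket z v)))
      = lin_trace scale (\<lambda>v. bracket x (bracket z (bracket y v)))"
    using lin_trace_commute[OF B mult_linear mult_mult_linear, of y x z] by (simp add: comp_def)
  also have "lin_trace scale (\<lambda>v. bracket x (bracket y (bracket z v)))
        - lin_trace scale (\<lambda>v. bracket x (bracket z (bracket y v)))
      = lin_trace scale (\<lambda>v. bracket x (bracket y (bracket z v)) - bracket x (bracket z (bracket y v)))"
    by (rule lin_trace_add_diff(2)[OF B lin3 lin3, symmetric])
  also have "\<dots> = killing_form scale bracket x (bracket y z)"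
  proof -
    have "bracket x (bracket (bracket y z) v)
        = bracket x (bracket y (bracket z v)) - bracket x (bracket z (bracket y v))" for v
      using bracket_simps(2)[of x "bracket (bracket y z) v" "bracket z (bracket y v)"]
      by (simp add: bracket_derivation[of y z])
    then show ?thesis unfolding killing_form_def comp_def by simp
  qed
  finally show "killing_form scale bracket (bracket x y) z = killing_form scale bracket x (bracket y z)" .
qed

lemma derived_subalgebra_eq: "derived_subalgebra scale bracket I = bracket_span I I"
  by (simp add: derived_subalgebra_def bracket_span_def)

lemma lie_subalgebra_derived:
  assumes "lie_subalgebra I"
  shows "lie_subalgebra (bracket_span I I)" "bracket_span I I \<subseteq> I"
proof -
  show le: "bracket_span I I \<subseteq> I" using assms unfolding lie_subalgebra_def by (intro bracket_span_leI) auto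
  then show "lie_subalgebra (bracket_span I I)"
    unfolding lie_subalgebra_def by (auto simp: bracket_span_def[of I I, THEN arg_cong[of _ _ subspace]] intro: bracket_spanI)
qed

text \<open>
  A term of least dimension equals its successor.
\<close>

lemma derived_series_stabilizes:
  assumes "lie_subalgebra I"
  obtains n where "lie_subalgebra ((derived_subalgebra scale bracket ^^ n) I)"
    and "(derived_subalgebra scale bracket ^^ n) I \<subseteq> I"
    and "bracket_span ((derived_subalgebra scale bracket ^^ n) I) ((derived_subalgebra scale bracket ^^ n) I)
      = (derived_subalgebra scale bracket ^^ n) I"
proof -
  obtain B where "finite_dimensional_vector_space scale B" using finite_dimensional by blast
  then interpret finite_dimensional_vector_space scale B .
  define D where "D n = (derived_subalgebra scale bracket ^^ n) I" for n
  have D_Suc: "D (Suc n) = bracket_span (D n) (D n)" for n by (simp add: D_def derived_subalgebra_eq)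
  have D: "lie_subalgebra (D n) \<and> D n \<subseteq> I" for n
  proof (induction n)
    case 0 then show ?case using assms by (simp add: D_def)
  next
    case (Suc n) then show ?case unfolding D_Suc using lie_subalgebra_derived by blast
  qed
  obtain n where n: "\<And>k. dim (D n) \<le> dim (D k)"
    using ex_has_least_nat[of "\<lambda>_. True" 0 "\<lambda>k. dim (D k)"] by auto
  have "D (Suc n) = D n"
    using D[of n] D[of "Suc n"] n[of "Suc n"] lie_subalgebra_derived(2)[of "D n"]
    by (intro subspace_dim_equal) (auto simp: lie_subalgebra_def D_Suc)
  with that[of n] D[of n] show thesis by (simp add: D_Suc flip: D_def)
qed

end

text \<open>
  If the derived series of the radical of the Killing form became stationary at a nonzero term, that
  term would be perfect with vanishing Killing form, hence would act nilpotently, and a perfect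
  subalgebra that acts nilpotently is zero. So the radical is a solvable ideal.
\<close>

theorem cartan_criterion:
  fixes s :: "'l::field_char_0 \<Rightarrow> 'g::ab_group_add \<Rightarrow> 'g"
  assumes "semisimple_lie_algebra s br"
  shows "nondegenerate_form (killing_form s br)"
proof -
  interpret semisimple_lie_algebra s br by fact
  let ?R = "{x. \<forall>y. killing_form s br x y = 0}"
  have subR: "subspace ?R" by (simp add: subspace_def killing_form_simps)
  have idealR: "br x y \<in> ?R" if "y \<in> ?R" for x y
  proof -
    have "killing_form s br (br x y) z = 0" for z
    proof -
      have "killing_form s br (br x y) z = - killing_form s br (br y x) z"
        by (simp add: anticommutative[of x y] killing_form_neg)
      also have "killing_form s br (br y x) z = killing_form s br y (br x z)"
        using killing_form_invariant by (simp add: invariant_form_def)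
      finally show ?thesis using that by simp
    qed
    then show ?thesis by simp
  qed
  have "lie_subalgebra ?R" using subR idealR by (simp add: lie_subalgebra_def)
  then obtain n where n: "lie_subalgebra ((derived_subalgebra s br ^^ n) ?R)"
    "(derived_subalgebra s br ^^ n) ?R \<subseteq> ?R"
    "bracket_span ((derived_subalgebra s br ^^ n) ?R) ((derived_subalgebra s br ^^ n) ?R)
      = (derived_subalgebra s br ^^ n) ?R"
    by (rule derived_series_stabilizes)
  have "(derived_subalgebra s br ^^ n) ?R = {0}"
  proof (rule perfect_nilpotent_trivial[OF n(1)])
    fix x assume "x \<in> (derived_subalgebra s br ^^ n) ?R"
    then show "\<exists>p. \<forall>v. (br x ^^ p) v = 0"
      by (rule perfect_trace_zero_imp_nilpotent[OF lie_algebra_axioms n(1), rotated 2])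
        (use n(2,3) in auto)
  qed (simp add: n(3))
  then have "lie_solvable s br ?R" unfolding lie_solvable_def by blast
  moreover have "lie_ideal s br ?R" unfolding lie_ideal_def using subR idealR by blast
  ultimately have "?R = {0}" by (intro semisimple)
  then show ?thesis unfolding nondegenerate_form_def by blast
qed

text \<open>
  The map \<open>z \<mapsto> \<Sum> h z b \<cdot> b\<close> is an injective endomorphism of a finite-dimensional space, hence
  surjective; it plays the role of the map to the dual space.
\<close>

lemma nondegenerate_form_represents:
  assumes fd: "finite_dimensional_vector_space s B"
    and h: "bilinear_form s h" "nondegenerate_form h" and \<theta>: "Vector_Spaces.linear s (*) \<theta>"
  obtains z where "\<And>x. h z x = \<theta> x"
proof -
  interpret finite_dimensional_vector_space s B by fact
  interpret p: finite_dimensional_vector_space_pair_1 s B s ..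
  define g where "g z = (\<Sum>b\<in>B. s (h z b) b)" for z
  have lin_h: "Vector_Spaces.linear s (*) (h z)" for z using h(1) by (simp add: bilinear_map_def)
  have lin: "Vector_Spaces.linear s s g"
    using h(1) by (simp add: Vector_Spaces.linear_iff bilinear_map_iff g_def vector_space_axioms
        scale_left_distrib sum.distrib scale_sum_right)
  have coords: "(\<Sum>b\<in>B. s (c b) b) = (\<Sum>b\<in>B. s (d b) b) \<Longrightarrow> b \<in> B \<Longrightarrow> c b = d b" for c d b
    using independentD[OF independent_Basis finite_Basis order_refl, of "\<lambda>b. c b - d b" b]
    by (simp add: scale_left_diff_distrib sum_subtractf)
  interpret g: Vector_Spaces.linear s s g by (rule lin)
  have hz: "h z x = \<theta>' x" if "Vector_Spaces.linear s (*) \<theta>'" "\<And>b. b \<in> B \<Longrightarrow> h z b = \<theta>' b" for z x \<theta>'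
  proof -
    interpret vector_space_pair s "(*)"
      by (simp add: vector_space_pair_def vector_space_axioms vector_space_mult)
    show ?thesis by (rule linear_eq_on[OF lin_h that(1) _ that(2)]) (simp_all add: span_Basis)
  qed
  have zero_lin: "Vector_Spaces.linear s (*) (\<lambda>_. 0 :: 'a)"
    by (simp add: Vector_Spaces.linear_iff vector_space_axioms vector_space_mult)
  have "z = 0" if "g z = 0" for z
  proof -
    have "h z b = 0" if "b \<in> B" for b
      using coords[of "h z" "\<lambda>_. 0" b] \<open>g z = 0\<close> that by (simp add: g_def)
    then have "h z x = 0" for x by (rule hz[OF zero_lin])
    then show ?thesis using h(2) unfolding nondegenerate_form_def by blast
  qed
  then have "inj g" by (simp add: g.inj_iff_eq_0)
  then have "surj g" by (rule linear_inj_imp_surj[OF lin])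
  then obtain z where "g z = (\<Sum>b\<in>B. s (\<theta> b) b)" by (metis surjD)
  then have "h z b = \<theta> b" if "b \<in> B" for b using coords[of "h z" \<theta> b] that by (simp add: g_def)
  then have "h z x = \<theta> x" for x by (rule hz[OF \<theta>])
  then show thesis by (rule that)
qed

lemma semisimple_ad_trace_zero:
  fixes s :: "'l::field_char_0 \<Rightarrow> 'g::ab_group_add \<Rightarrow> 'g"
  assumes "semisimple_lie_algebra s br"
  shows "lin_trace s (br x) = 0"
proof -
  interpret semisimple_lie_algebra s br by fact
  note nondeg = cartan_criterion[OF assms]
  obtain B where fd: "finite_dimensional_vector_space s B" using finite_dimensional by blast
  \<comment> \<open>The trace of \<open>ad x\<close> is a linear form in \<open>x\<close>; its representing vector \<open>z\<close> turns out to be central.\<close>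
  obtain z where z: "\<And>x. killing_form s br z x = lin_trace s (br x)"
    using nondegenerate_form_represents[OF fd killing_form_bilinear nondeg lin_trace_mult_linear] by blast
  have tr0: "lin_trace s (br (br x y)) = 0" for x y
  proof -
    have "br (br x y) = (\<lambda>v. br x (br y v) - br y (br x v))"
      by (simp add: fun_eq_iff bracket_derivation[of x y])
    then show ?thesis
      using lin_trace_commute[OF fd mult_linear mult_linear, of x y]
      by (simp add: lin_trace_add_diff(2)[OF fd mult_mult_linear mult_mult_linear] comp_def)
  qed
  have "killing_form s br (br z x) y = 0" for x y
    using killing_form_invariant tr0[of x y] z[of "br x y"] by (simp add: invariant_form_def)
  then have "br z x = 0" for x using nondeg unfolding nondegenerate_form_def by blast
  then have "killing_form s br z x = killing_form s br 0 x"
    unfolding killing_form_def by (simp add: comp_def)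
  then show ?thesis using z[of x] by simp
qed

section \<open>Tensor products of metrized and of semisimple algebras\<close>

lemma bilinear_map_neg_neg:
  assumes "bilinear_map s1 s2 s3 f"
  shows "f (- x) (- y) = f x y"
proof -
  interpret l: Vector_Spaces.linear s1 s3 "\<lambda>x. f x (- y)" using assms by (simp add: bilinear_map_def)
  interpret r: Vector_Spaces.linear s2 s3 "f x" using assms by (simp add: bilinear_map_def)
  show ?thesis by (simp add: l.neg r.neg)
qed

lemma tensor_metrized_exact:
  assumes M1: "metrized_comm_algebra s1 m1 h1" and M2: "metrized_comm_algebra s2 m2 h2"
    and exact: "exact_comm_algebra s1 m1 \<or> exact_comm_algebra s2 m2"
    and tp: "is_tensor_product s1 s2 st t"
  shows "metrized_comm_algebra st (tensor_mult st t m1 m2) (tensor_form st t h1 h2)"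
    and "exact_comm_algebra st (tensor_mult st t m1 m2)"
proof -
  interpret M1: metrized_comm_algebra s1 m1 h1 by fact
  interpret M2: metrized_comm_algebra s2 m2 h2 by fact
  have comm: "comm_algebra st (tensor_mult st t m1 m2)"
    by (rule tensor_comm_algebra[OF tp M1.fd_algebra_axioms M2.fd_algebra_axioms])
      (simp only: M1.commutative M2.commutative)
  show "metrized_comm_algebra st (tensor_mult st t m1 m2) (tensor_form st t h1 h2)"
    by (rule tensor_metrized[OF tp M1.fd_algebra_axioms M2.fd_algebra_axioms comm
          M1.bilinear_metric M1.symmetric_metric M1.nondegenerate_metric M1.invariant_metric
          M2.bilinear_metric M2.symmetric_metric M2.nondegenerate_metric M2.invariant_metric])
  have "(\<forall>x. lin_trace s1 (m1 x) = 0) \<or> (\<forall>x. lin_trace s2 (m2 x) = 0)"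
    using exact exact_comm_algebra.exact[of s1 m1] exact_comm_algebra.exact[of s2 m2] by blast
  then show "exact_comm_algebra st (tensor_mult st t m1 m2)"
    by (rule tensor_exact[OF tp M1.fd_algebra_axioms M2.fd_algebra_axioms comm])
qed

lemma (in killing_metrized_comm_algebra) killing_form_metrizes:
  "metrized_comm_algebra scale mult (killing_form scale mult)"
  by unfold_locales
    (fact killing_form_bilinear killing_form_symmetric nondegenerate_killing invariant_killing)+

text \<open>
  The metric that the tensor product inherits from the two Killing forms is its own Killing form.
\<close>

lemma tensor_killing_metrized:
  assumes K1: "killing_metrized_comm_algebra s1 m1" and K2: "killing_metrized_comm_algebra s2 m2"
    and exact: "exact_comm_algebra s1 m1 \<or> exact_comm_algebra s2 m2"
    and tp: "is_tensor_product s1 s2 st t"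
  shows "killing_metrized_comm_algebra st (tensor_mult st t m1 m2)"
    and "exact_comm_algebra st (tensor_mult st t m1 m2)"
proof -
  interpret K1: killing_metrized_comm_algebra s1 m1 by fact
  interpret K2: killing_metrized_comm_algebra s2 m2 by fact
  note T = tensor_metrized_exact[OF K1.killing_form_metrizes K2.killing_form_metrizes exact tp]
  interpret M: metrized_comm_algebra st "tensor_mult st t m1 m2"
    "tensor_form st t (killing_form s1 m1) (killing_form s2 m2)" by (rule T(1))
  note K = tensor_killing_form[OF tp K1.fd_algebra_axioms K2.fd_algebra_axioms M.comm_algebra_axioms]
  show "exact_comm_algebra st (tensor_mult st t m1 m2)" by (rule T(2))
  show "killing_metrized_comm_algebra st (tensor_mult st t m1 m2)"
    by unfold_locales (simp_all add: K M.nondegenerate_metric M.invariant_metric)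
qed

lemma tensor_semisimple_killing_einstein:
  fixes sg :: "'l::field_char_0 \<Rightarrow> 'g::ab_group_add \<Rightarrow> 'g"
  assumes G: "semisimple_lie_algebra sg brg" and H: "semisimple_lie_algebra sh brh"
    and tp: "is_tensor_product sg sh su u"
  shows "killing_einstein su (tensor_mult su u brg brh)"
    and "exact_comm_algebra su (tensor_mult su u brg brh)"
proof -
  interpret G: semisimple_lie_algebra sg brg by fact
  interpret H: semisimple_lie_algebra sh brh by fact
  have comm: "comm_algebra su (tensor_mult su u brg brh)"
  proof (rule tensor_comm_algebra[OF tp G.fd_algebra_axioms H.fd_algebra_axioms])
    fix a a' b b'
    show "u (brg a a') (brh b b') = u (brg a' a) (brh b' b)"
      unfolding G.anticommutative[of a a'] H.anticommutative[of b b']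
      by (rule bilinear_map_neg_neg[OF is_tensor_product_bilinear[OF tp]])
  qed
  show "exact_comm_algebra su (tensor_mult su u brg brh)"
    by (rule tensor_exact[OF tp G.fd_algebra_axioms H.fd_algebra_axioms comm])
      (simp add: semisimple_ad_trace_zero[OF G])
  have "metrized_comm_algebra su (tensor_mult su u brg brh)
      (tensor_form su u (killing_form sg brg) (killing_form sh brh))"
    by (rule tensor_metrized[OF tp G.fd_algebra_axioms H.fd_algebra_axioms comm
          G.killing_form_bilinear G.killing_form_symmetric cartan_criterion[OF G] G.killing_form_invariant
          H.killing_form_bilinear H.killing_form_symmetric cartan_criterion[OF H] H.killing_form_invariant])
  then show "killing_einstein su (tensor_mult su u brg brh)"
    unfolding killing_einstein_def
      tensor_killing_form[OF tp G.fd_algebra_axioms H.fd_algebra_axioms comm]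
    by (intro exI[of _ "tensor_form su u (killing_form sg brg) (killing_form sh brh)"] exI[of _ 1]) simp
qed

theorem lemma2p8:
  fixes s1 :: "'k::field \<Rightarrow> 'a::ab_group_add \<Rightarrow> 'a" and m1 :: "'a \<Rightarrow> 'a \<Rightarrow> 'a"
    and s2 :: "'k \<Rightarrow> 'b::ab_group_add \<Rightarrow> 'b" and m2 :: "'b \<Rightarrow> 'b \<Rightarrow> 'b"
    and st :: "'k \<Rightarrow> 'c::ab_group_add \<Rightarrow> 'c" and t :: "'a \<Rightarrow> 'b \<Rightarrow> 'c"
    and h1 :: "'a \<Rightarrow> 'a \<Rightarrow> 'k" and h2 :: "'b \<Rightarrow> 'b \<Rightarrow> 'k"
    and sg :: "'l::field_char_0 \<Rightarrow> 'g::ab_group_add \<Rightarrow> 'g" and brg :: "'g \<Rightarrow> 'g \<Rightarrow> 'g"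
    and sh :: "'l \<Rightarrow> 'h::ab_group_add \<Rightarrow> 'h" and brh :: "'h \<Rightarrow> 'h \<Rightarrow> 'h"
    and su :: "'l \<Rightarrow> 'u::ab_group_add \<Rightarrow> 'u" and u :: "'g \<Rightarrow> 'h \<Rightarrow> 'u"
  shows
    "(metrized_comm_algebra s1 m1 h1 \<and> metrized_comm_algebra s2 m2 h2 \<and>
      (exact_comm_algebra s1 m1 \<or> exact_comm_algebra s2 m2) \<and>
      is_tensor_product s1 s2 st t
      \<longrightarrow> metrized_comm_algebra st (tensor_mult st t m1 m2) (tensor_form st t h1 h2) \<and>
          exact_comm_algebra st (tensor_mult st t m1 m2))
     \<and>
     (killing_metrized_comm_algebra s1 m1 \<and> killing_metrized_comm_algebra s2 m2 \<and>
      (exact_comm_algebra s1 m1 \<or> exact_comm_algebra s2 m2) \<and>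
      is_tensor_product s1 s2 st t
      \<longrightarrow> killing_metrized_comm_algebra st (tensor_mult st t m1 m2) \<and>
          exact_comm_algebra st (tensor_mult st t m1 m2))
     \<and>
     (semisimple_lie_algebra sg brg \<and> semisimple_lie_algebra sh brh \<and>
      is_tensor_product sg sh su u
      \<longrightarrow> killing_einstein su (tensor_mult su u brg brh) \<and>
          exact_comm_algebra su (tensor_mult su u brg brh))"
  using tensor_metrized_exact[of s1 m1 h1 s2 m2 h2 st t] tensor_killing_metrized[of s1 m1 s2 m2 st t]
    tensor_semisimple_killing_einstein[of sg brg sh brh su u]
  by blast

end
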